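(* Let $\mathcal{R}$ be a set of $n$ unit intervals. Given an $(\alpha, \beta)$-smooth sorting-supersequence $\Xi$ of $\mathcal{R}$, and given a realization $P$ of $\mathcal{R}$, the sorted order of $P$ can be computed in $O(|\Xi|\log(\alpha \beta))$ time on a Real RAM.
   Context: Let $\mathcal{R}=\{R_1,\dots,R_n\}$ be a set of intervals on the real line; unit intervals are intervals of length 1. A realization of $\mathcal{R}$ is a point set $P=\{p_1,\dots,p_n\}$ with $p_i\in R_i$ for each $i$. A sorting-supersequence of $\mathcal{R}$ is a sequence $\Xi$ of (possibly reoccurring) intervals of $\mathcal{R}$ such that, for any realization $P$ of $\mathcal{R}$, the sorted order of $P$ (written as the sequence of corresponding intervals) is a subsequence of $\Xi$. A sequence of values $X=x_1,\dots,x_n$ is $(\alpha,\beta)$-smooth if (distance property) for any $i<j$ with $x_i>x_j$ we have $x_i-x_j\le\alpha$, and (packing property) for any interval $J\subset\mathbb{R}$ with $|J|>1$ there are at most $\beta|J|$ distinct elements of $X$ in $J$. A sorting-supersequence $\Xi$ is $(\alpha,\beta)$-smooth if, for every realization $P$ of $\mathcal{R}$, the sequence of values obtained by replacing each interval in $\Xi$ by its point in $P$ is $(\alpha,\beta)$-smooth. The intervals in $\Xi$ are given as pointers to the intervals of $\mathcal{R}$, which are linked bidirectionally to their points in $P$. *)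

theory Defs
  imports "HOL-Analysis.Analysis" "HOL-Library.Sublist"
begin

text \<open>
  A family of intervals \<open>R\<^sub>0, \<dots>, R\<^sub>n\<^sub>-\<^sub>1\<close> is a list of sets of reals; a reference to one of them
  is its index, and the point of the \<open>i\<close>-th interval in a realization \<open>P\<close> is \<open>P ! i\<close>.
\<close>

definition bounded_interval :: "real set \<Rightarrow> bool" where
  "bounded_interval J \<longleftrightarrow> is_interval J \<and> bounded J \<and> J \<noteq> {}"

definition interval_length :: "real set \<Rightarrow> real" where
  "interval_length J = Sup J - Inf J"

definition unit_interval :: "real set \<Rightarrow> bool" where
  "unit_interval J \<longleftrightarrow> bounded_interval J \<and> interval_length J = 1"

definition realization :: "real set list \<Rightarrow> real list \<Rightarrow> bool" where
  "realization R P \<longleftrightarrow> length P = length R \<and> (\<forall>i < length R. P ! i \<in> R ! i)"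

text \<open>
  If points of \<open>P\<close> coincide there are several sorted orders, one for each way of breaking ties.
\<close>

definition sorted_order :: "real list \<Rightarrow> nat list \<Rightarrow> bool" where
  "sorted_order P \<sigma> \<longleftrightarrow>
     distinct \<sigma> \<and> set \<sigma> = {..<length P} \<and> sorted (map (\<lambda>i. P ! i) \<sigma>)"

definition sorting_supersequence :: "real set list \<Rightarrow> nat list \<Rightarrow> bool" where
  "sorting_supersequence R \<Xi> \<longleftrightarrow>
     set \<Xi> \<subseteq> {..<length R} \<and>
     (\<forall>P. realization R P \<longrightarrow> (\<exists>\<sigma>. sorted_order P \<sigma> \<and> subseq \<sigma> \<Xi>))"

definition smooth :: "real \<Rightarrow> real \<Rightarrow> real list \<Rightarrow> bool" where
  "smooth \<alpha> \<beta> X \<longleftrightarrow>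
     (\<forall>i j. i < j \<and> j < length X \<and> X ! i > X ! j \<longrightarrow> X ! i - X ! j \<le> \<alpha>) \<and>
     (\<forall>J. bounded_interval J \<and> interval_length J > 1 \<longrightarrow>
        real (card (set X \<inter> J)) \<le> \<beta> * interval_length J)"

definition smooth_supersequence ::
  "real \<Rightarrow> real \<Rightarrow> real set list \<Rightarrow> nat list \<Rightarrow> bool" where
  "smooth_supersequence \<alpha> \<beta> R \<Xi> \<longleftrightarrow>
     sorting_supersequence R \<Xi> \<and>
     (\<forall>P. realization R P \<longrightarrow> smooth \<alpha> \<beta> (map (\<lambda>i. P ! i) \<Xi>))"

text \<open>
  The real RAM: a stored program acting on a random access memory for natural numbers
  (pointers and counters) and one for real numbers, each with a register file and indirect
  addressing through integer registers. Every instruction costs one time unit. The integer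
  side has only addition and truncated subtraction as arithmetic, since unit-cost multiplication of
  unbounded integers would be unreasonably powerful; reals cannot be rounded to integers.
  As usual in HOL, division by zero yields zero.
\<close>

datatype instr =
    IConst nat nat           \<comment> \<open>destination, constant\<close>
  | IMove nat nat            \<comment> \<open>destination, source\<close>
  | IAdd nat nat nat         \<comment> \<open>destination, operands; likewise below\<close>
  | ISub nat nat nat
  | ILoad nat nat            \<comment> \<open>destination, register holding the address\<close>
  | IStore nat nat           \<comment> \<open>register holding the address, source\<close>
  | RConst nat int
  | RMove nat nat
  | RCast nat nat            \<comment> \<open>destination, integer register\<close>
  | RAdd nat nat nat
  | RSub nat nat nat
  | RMul nat nat nat
  | RDiv nat nat nat
  | RLoad nat nat
  | RStore nat nat
  | Jump nat                 \<comment> \<open>target\<close>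
  | JumpILess nat nat nat    \<comment> \<open>operands, target\<close>
  | JumpIEq nat nat nat
  | JumpRLess nat nat nat
  | JumpREq nat nat nat

record config =
  pc :: nat
  ireg :: "nat \<Rightarrow> nat"
  rreg :: "nat \<Rightarrow> real"
  imem :: "nat \<Rightarrow> nat"
  rmem :: "nat \<Rightarrow> real"

definition set_ireg :: "nat \<Rightarrow> nat \<Rightarrow> config \<Rightarrow> config" where
  "set_ireg d v s = s\<lparr>pc := Suc (pc s), ireg := (ireg s)(d := v)\<rparr>"

definition set_rreg :: "nat \<Rightarrow> real \<Rightarrow> config \<Rightarrow> config" where
  "set_rreg d v s = s\<lparr>pc := Suc (pc s), rreg := (rreg s)(d := v)\<rparr>"

definition branch :: "bool \<Rightarrow> nat \<Rightarrow> config \<Rightarrow> config" where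
  "branch b l s = s\<lparr>pc := (if b then l else Suc (pc s))\<rparr>"

fun exec :: "instr \<Rightarrow> config \<Rightarrow> config" where
  "exec (IConst d c) s = set_ireg d c s"
| "exec (IMove d a) s = set_ireg d (ireg s a) s"
| "exec (IAdd d a b) s = set_ireg d (ireg s a + ireg s b) s"
| "exec (ISub d a b) s = set_ireg d (ireg s a - ireg s b) s"
| "exec (ILoad d a) s = set_ireg d (imem s (ireg s a)) s"
| "exec (IStore a b) s = s\<lparr>pc := Suc (pc s), imem := (imem s)(ireg s a := ireg s b)\<rparr>"
| "exec (RConst d c) s = set_rreg d (of_int c) s"
| "exec (RMove d a) s = set_rreg d (rreg s a) s"
| "exec (RCast d a) s = set_rreg d (real (ireg s a)) s"
| "exec (RAdd d a b) s = set_rreg d (rreg s a + rreg s b) s"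
| "exec (RSub d a b) s = set_rreg d (rreg s a - rreg s b) s"
| "exec (RMul d a b) s = set_rreg d (rreg s a * rreg s b) s"
| "exec (RDiv d a b) s = set_rreg d (rreg s a / rreg s b) s"
| "exec (RLoad d a) s = set_rreg d (rmem s (ireg s a)) s"
| "exec (RStore a b) s = s\<lparr>pc := Suc (pc s), rmem := (rmem s)(ireg s a := rreg s b)\<rparr>"
| "exec (Jump l) s = branch True l s"
| "exec (JumpILess a b l) s = branch (ireg s a < ireg s b) l s"
| "exec (JumpIEq a b l) s = branch (ireg s a = ireg s b) l s"
| "exec (JumpRLess a b l) s = branch (rreg s a < rreg s b) l s"
| "exec (JumpREq a b l) s = branch (rreg s a = rreg s b) l s"

text \<open>The machine halts by leaving the program.\<close>

definition halted :: "instr list \<Rightarrow> config \<Rightarrow> bool" where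
  "halted prog s \<longleftrightarrow> length prog \<le> pc s"

definition step :: "instr list \<Rightarrow> config \<Rightarrow> config" where
  "step prog s = (if halted prog s then s else exec (prog ! pc s) s)"

definition run :: "instr list \<Rightarrow> nat \<Rightarrow> config \<Rightarrow> config" where
  "run prog t s = (step prog ^^ t) s"

text \<open>
  With \<open>n = length R\<close>, the input is laid out as follows. Integer registers 0 and 1 hold \<open>n\<close> and
  the length of \<open>\<Xi>\<close>; the integer memory holds the entries of \<open>\<Xi>\<close>, which are references to
  intervals; the real memory holds the point, the left endpoint and the right endpoint of interval
  \<open>i\<close> at addresses \<open>i\<close>, \<open>n + i\<close> and \<open>2 * n + i\<close>, so that the common index \<open>i\<close> links an interval
  and its point in both directions. Everything else is zero.
\<close>

definition initial_config :: "real set list \<Rightarrow> nat list \<Rightarrow> real list \<Rightarrow> config" where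
  "initial_config R \<Xi> P =
     (let rs = P @ map Inf R @ map Sup R in
      \<lparr>pc = 0,
       ireg = (\<lambda>_. 0)(0 := length R, 1 := length \<Xi>),
       rreg = (\<lambda>_. 0),
       imem = (\<lambda>a. if a < length \<Xi> then \<Xi> ! a else 0),
       rmem = (\<lambda>a. if a < length rs then rs ! a else 0)\<rparr>)"

text \<open>The output is an array of \<open>n\<close> references whose start address is left in integer register 0.\<close>

definition output_array :: "nat \<Rightarrow> config \<Rightarrow> nat list" where
  "output_array n s = map (\<lambda>k. imem s (ireg s 0 + k)) [0..<n]"

end

theory Submission
  imports Defs "HOL-Library.Multiset"
begin

text \<open>
  Remove the repetitions from \<open>\<Xi>\<close>. If two points of \<open>P\<close> are out of order in the result, then
  \<open>\<alpha> \<ge> 1\<close>, and everything between them lies in one of two windows of length \<open>\<alpha>\<close>; by the packing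
  property, inversions thus occur only between positions at distance less than \<open>2 * \<alpha> * \<beta>\<close>.

  Bottom-up mergesort preserves this locality. Once the blocks are at least as long as the
  distance bound, merging the second half of each pair of blocks with the first half of the next
  pair sorts the whole list. The program does not know \<open>\<alpha>\<close> and \<open>\<beta>\<close>, so in every round it performs
  this shifted pass into a separate array and stops as soon as that array is sorted, which
  happens after \<open>O(log (\<alpha> * \<beta>))\<close> rounds of linear cost.
\<close>

section \<open>Structured programs for the real RAM\<close>

text \<open>The packing property is silent about windows of length at most 1, so
  \<open>1 \<le> \<alpha>\<close> has to come from the distance property. That property holds for
  all realizations, and moving two points towards the endpoints of their intervals tests it at its
  worst. Intervals may be open and points may coincide, so endpoints and distinctness are available
  only up to small errors. If \<open>P\<close> causes no inversion, \<alpha> * \<beta> can even be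
  negative, which \<open>max 2\<close> absorbs.

  With sorted blocks of length \<open>2 * w\<close> and inversions at distance below
  \<open>w\<close>, an entry can be misplaced only relative to the adjoining half of a neighbouring
  block; this is why the shifted pass succeeds. Its sorted runs are offset by \<open>w\<close> from
  the grid of the next doubling, so the rounds continue from the unshifted output. Testing for
  sortedness replaces a logarithm that the machine cannot compute.\<close>

datatype cond = ILess nat nat | RLess nat nat

datatype com =
    Do "instr list"
  | Seq com com  (infixr ";;" 60)
  | Cond cond com com
  | While cond com

fun straight :: "instr \<Rightarrow> bool" where
  "straight (Jump _) = False"
| "straight (JumpILess _ _ _) = False"
| "straight (JumpIEq _ _ _) = False"
| "straight (JumpRLess _ _ _) = False"
| "straight (JumpREq _ _ _) = False"
| "straight _ = True"

primrec holds :: "cond \<Rightarrow> config \<Rightarrow> bool" where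
  "holds (ILess a b) s = (ireg s a < ireg s b)"
| "holds (RLess a b) s = (rreg s a < rreg s b)"

primrec jump_if :: "cond \<Rightarrow> nat \<Rightarrow> instr" where
  "jump_if (ILess a b) l = JumpILess a b l"
| "jump_if (RLess a b) l = JumpRLess a b l"

text \<open>Sizes do not depend on the address, so the targets of forward jumps are known before the
  code behind them is laid out. \<open>Cond\<close> stores its second branch first; only that branch
  pays for a jump over the other one, whence the different costs in \<open>big_step\<close>.\<close>

primrec code_size :: "com \<Rightarrow> nat" where
  "code_size (Do is) = length is"
| "code_size (c ;; d) = code_size c + code_size d"
| "code_size (Cond b c d) = code_size c + code_size d + 2"
| "code_size (While b c) = code_size c + 3"

text \<open>Jump targets are absolute, so the first argument is the address at which the code is placed.\<close>

primrec compile :: "nat \<Rightarrow> com \<Rightarrow> instr list" where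
  "compile k (Do is) = is"
| "compile k (c ;; d) = compile k c @ compile (k + code_size c) d"
| "compile k (Cond b c d) =
     jump_if b (k + code_size d + 2) # compile (Suc k) d
     @ Jump (k + code_size c + code_size d + 2) # compile (k + code_size d + 2) c"
| "compile k (While b c) =
     jump_if b (k + 2) # Jump (k + code_size c + 3) # compile (k + 2) c @ [Jump k]"

lemma length_compile [simp]: "length (compile k c) = code_size c"
  by (induction c arbitrary: k) auto

text \<open>The number is the running time of the compiled code; the program counter of the
  configurations is irrelevant.\<close>

inductive big_step :: "com \<Rightarrow> config \<Rightarrow> nat \<Rightarrow> config \<Rightarrow> bool" where
  Do: "list_all straight is \<Longrightarrow> big_step (Do is) s (length is) (fold exec is s)"
| Seq: "big_step c s t s' \<Longrightarrow> big_step d s' t' s'' \<Longrightarrow> big_step (c ;; d) s (t + t') s''"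
| CondTrue: "holds b s \<Longrightarrow> big_step c s t s' \<Longrightarrow> big_step (Cond b c d) s (t + 1) s'"
| CondFalse: "\<not> holds b s \<Longrightarrow> big_step d s t s' \<Longrightarrow> big_step (Cond b c d) s (t + 2) s'"
| WhileFalse: "\<not> holds b s \<Longrightarrow> big_step (While b c) s 2 s"
| WhileTrue: "holds b s \<Longrightarrow> big_step c s t s' \<Longrightarrow> big_step (While b c) s' t' s'' \<Longrightarrow>
    big_step (While b c) s (t + t' + 2) s''"

section \<open>Correctness of compilation\<close>

primrec code_at :: "instr list \<Rightarrow> nat \<Rightarrow> instr list \<Rightarrow> bool" where
  "code_at prog k [] = True"
| "code_at prog k (i # is) = (k < length prog \<and> prog ! k = i \<and> code_at prog (Suc k) is)"

lemma code_at_append [simp]: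
  "code_at prog k (xs @ ys) = (code_at prog k xs \<and> code_at prog (k + length xs) ys)"
  by (induction xs arbitrary: k) auto

lemma code_at_suffix: "code_at (ys @ xs) (length ys) xs"
proof (induction xs arbitrary: ys)
  case (Cons x xs)
  from Cons[of "ys @ [x]"] show ?case by simp
qed simp

lemma run_0 [simp]: "run prog 0 s = s"
  by (simp add: run_def)

lemma run_Suc: "run prog (Suc t) s = run prog t (step prog s)"
  by (simp add: run_def funpow_swap1)

lemma run_add: "run prog (t + t') s = run prog t' (run prog t s)"
  by (simp add: run_def funpow_add add.commute[of t])

lemma exec_straight:
  "straight i \<Longrightarrow> exec i (s\<lparr>pc := k\<rparr>) = (exec i s)\<lparr>pc := Suc k\<rparr>"
  by (cases i) (auto simp: set_ireg_def set_rreg_def)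

lemma exec_jump_if:
  "exec (jump_if b l) s = s\<lparr>pc := if holds b s then l else Suc (pc s)\<rparr>"
  by (cases b) (auto simp: branch_def)

lemma holds_pc [simp]: "holds b (s\<lparr>pc := k\<rparr>) = holds b s"
  by (cases b) auto

lemma run_straight:
  "list_all straight is \<Longrightarrow> code_at prog k is \<Longrightarrow>
   run prog (length is) (s\<lparr>pc := k\<rparr>) = (fold exec is s)\<lparr>pc := k + length is\<rparr>"
proof (induction "is" arbitrary: k s)
  case (Cons i "is")
  have "step prog (s\<lparr>pc := k\<rparr>) = (exec i s)\<lparr>pc := Suc k\<rparr>"
    using Cons.prems by (auto simp: step_def halted_def exec_straight)
  then show ?case using Cons by (simp add: run_Suc)
qed simp

lemma step_jump_if:
  "k < length prog \<Longrightarrow> prog ! k = jump_if b l \<Longrightarrow>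
   step prog (s\<lparr>pc := k\<rparr>) = s\<lparr>pc := if holds b s then l else Suc k\<rparr>"
  by (simp add: step_def halted_def exec_jump_if)

lemma step_Jump:
  "k < length prog \<Longrightarrow> prog ! k = Jump l \<Longrightarrow> step prog (s\<lparr>pc := k\<rparr>) = s\<lparr>pc := l\<rparr>"
  by (simp add: step_def halted_def branch_def)

text \<open>Stated for code embedded anywhere in \<open>prog\<close>, so that the induction applies
  to the parts of a command. Overwriting \<open>pc\<close> on both sides discards the meaningless
  counter that \<open>big_step\<close> carries along.\<close>

theorem compile_correct:
  "big_step c s t s' \<Longrightarrow> code_at prog k (compile k c) \<Longrightarrow>
   run prog t (s\<lparr>pc := k\<rparr>) = s'\<lparr>pc := k + code_size c\<rparr>"
proof (induction arbitrary: k rule: big_step.induct)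
  case (Do "is" s)
  then show ?case by (simp add: run_straight)
next
  case (Seq c s t s' d t' s'')
  then show ?case by (simp add: run_add add.assoc)
next
  case (CondTrue b s c t s' d)
  let ?l = "k + code_size d + 2"
  have "step prog (s\<lparr>pc := k\<rparr>) = s\<lparr>pc := ?l\<rparr>"
    using CondTrue.prems CondTrue.hyps by (auto simp: step_jump_if)
  moreover have "run prog t (s\<lparr>pc := ?l\<rparr>) = s'\<lparr>pc := ?l + code_size c\<rparr>"
    using CondTrue.prems by (intro CondTrue.IH) simp
  ultimately show ?case by (simp add: run_Suc algebra_simps)
next
  case (CondFalse b s d t s' c)
  have "step prog (s\<lparr>pc := k\<rparr>) = s\<lparr>pc := Suc k\<rparr>"
    using CondFalse.prems CondFalse.hyps by (auto simp: step_jump_if)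
  moreover have "run prog t (s\<lparr>pc := Suc k\<rparr>) = s'\<lparr>pc := Suc k + code_size d\<rparr>"
    using CondFalse.prems by (intro CondFalse.IH) simp
  moreover have "step prog (s'\<lparr>pc := Suc k + code_size d\<rparr>) =
      s'\<lparr>pc := k + code_size c + code_size d + 2\<rparr>"
    using CondFalse.prems by (intro step_Jump) auto
  ultimately show ?case
    using run_add[of prog "Suc t" 1 "s\<lparr>pc := k\<rparr>"] by (simp add: run_Suc algebra_simps)
next
  case (WhileFalse b s c)
  have "step prog (s\<lparr>pc := k\<rparr>) = s\<lparr>pc := Suc k\<rparr>"
    using WhileFalse by (auto simp: step_jump_if)
  moreover have "step prog (s\<lparr>pc := Suc k\<rparr>) = s\<lparr>pc := k + code_size c + 3\<rparr>"
    using WhileFalse by (intro step_Jump) auto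
  ultimately show ?case by (simp add: run_Suc numeral_2_eq_2)
next
  case (WhileTrue b s c t s' t' s'')
  have "step prog (s\<lparr>pc := k\<rparr>) = s\<lparr>pc := k + 2\<rparr>"
    using WhileTrue.prems WhileTrue.hyps by (auto simp: step_jump_if)
  moreover have "run prog t (s\<lparr>pc := k + 2\<rparr>) = s'\<lparr>pc := k + 2 + code_size c\<rparr>"
    using WhileTrue.prems by (intro WhileTrue.IH) simp
  moreover have "step prog (s'\<lparr>pc := k + 2 + code_size c\<rparr>) = s'\<lparr>pc := k\<rparr>"
    using WhileTrue.prems by (intro step_Jump) auto
  moreover have "run prog t' (s'\<lparr>pc := k\<rparr>) = s''\<lparr>pc := k + code_size (While b c)\<rparr>"
    using WhileTrue.prems by (intro WhileTrue.IH)
  ultimately have "run prog (Suc t + 1 + t') (s\<lparr>pc := k\<rparr>) = s''\<lparr>pc := k + code_size (While b c)\<rparr>"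
    by (simp only: run_add One_nat_def run_Suc run_0)
  then show ?case by (simp add: algebra_simps)
qed

text \<open>Weakest preconditions with time credits: an assertion also speaks about the number of
  steps that may still be spent.\<close>

definition wp :: "com \<Rightarrow> (config \<Rightarrow> nat \<Rightarrow> bool) \<Rightarrow> config \<Rightarrow> nat \<Rightarrow> bool" where
  "wp c Q s n \<longleftrightarrow> (\<exists>t s'. big_step c s t s' \<and> t \<le> n \<and> Q s' (n - t))"

lemma wp_mono: "wp c Q s n \<Longrightarrow> (\<And>s' n'. Q s' n' \<Longrightarrow> Q' s' n') \<Longrightarrow> wp c Q' s n"
  unfolding wp_def by blast

lemma wp_Do:
  "list_all straight is \<Longrightarrow> length is \<le> n \<Longrightarrow> Q (fold exec is s) (n - length is) \<Longrightarrow>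
   wp (Do is) Q s n"
  unfolding wp_def by (blast intro: big_step.Do)

lemma wp_Seq: "wp c (wp d Q) s n \<Longrightarrow> wp (c ;; d) Q s n"
  unfolding wp_def
  by clarify (intro exI conjI, erule (1) big_step.Seq, auto simp: diff_diff_eq)

lemma wp_Cond:
  assumes "2 \<le> n" and "holds b s \<Longrightarrow> wp c Q s (n - 1)" and "\<not> holds b s \<Longrightarrow> wp d Q s (n - 2)"
  shows "wp (Cond b c d) Q s n"
proof (cases "holds b s")
  case True
  with assms obtain t s' where *: "big_step c s t s'" "t \<le> n - 1" "Q s' (n - 1 - t)"
    unfolding wp_def by blast
  with True assms(1) show ?thesis
    unfolding wp_def using CondTrue[OF True *(1)] by (intro exI[of _ "t + 1"] exI[of _ s']) auto
next
  case False
  with assms obtain t s' where *: "big_step d s t s'" "t \<le> n - 2" "Q s' (n - 2 - t)"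
    unfolding wp_def by blast
  moreover have "n - (t + 2) = n - 2 - t" by simp
  ultimately show ?thesis using False assms(1)
    unfolding wp_def using CondFalse[OF False *(1)] by (intro exI[of _ "t + 2"] exI[of _ s']) auto
qed

text \<open>Every iteration spends a credit, hence no separate termination measure is needed.\<close>

lemma wp_While:
  assumes "Inv s n"
    and body: "\<And>s n. Inv s n \<Longrightarrow> holds b s \<Longrightarrow> 2 \<le> n \<and> wp c Inv s (n - 2)"
    and exit: "\<And>s n. Inv s n \<Longrightarrow> \<not> holds b s \<Longrightarrow> 2 \<le> n \<and> Q s (n - 2)"
  shows "wp (While b c) Q s n"
  using assms(1)
proof (induction n arbitrary: s rule: less_induct)
  case (less n)
  show ?case
  proof (cases "holds b s")
    case True
    with body[OF less.prems] obtain t s' where *: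
      "big_step c s t s'" "t \<le> n - 2" "Inv s' (n - 2 - t)" "2 \<le> n"
      unfolding wp_def by blast
    with less.IH[of "n - 2 - t" s'] obtain t' s'' where **:
      "big_step (While b c) s' t' s''" "t' \<le> n - 2 - t" "Q s'' (n - 2 - t - t')"
      unfolding wp_def by auto
    moreover have "n - (t + t' + 2) = n - 2 - t - t'" by simp
    ultimately show ?thesis using * WhileTrue[OF True *(1) **(1)]
      unfolding wp_def by (intro exI[of _ "t + t' + 2"] exI[of _ s'']) auto
  next
    case False
    with exit[OF less.prems] show ?thesis
      unfolding wp_def by (blast intro: WhileFalse)
  qed
qed

lemma wp_run:
  assumes "wp c Q s n" and "pc s = 0"
  obtains t s' where "t \<le> n" and "run (compile 0 c) t s = s'\<lparr>pc := code_size c\<rparr>" and "Q s' (n - t)"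
proof -
  from assms(1) obtain t s' where "big_step c s t s'" "t \<le> n" "Q s' (n - t)"
    unfolding wp_def by blast
  moreover have "code_at (compile 0 c) 0 (compile 0 c)"
    using code_at_suffix[of "[]"] by simp
  moreover have "s = s\<lparr>pc := 0\<rparr>" using assms(2) by simp
  ultimately show ?thesis using that compile_correct[of c s t s' "compile 0 c" 0] by auto
qed

section \<open>Merge passes on locally ordered lists\<close>

text \<open>The machine moves references and compares their points, hence the key function. The
  strict test is the one that \<open>RLess\<close> evaluates.\<close>

fun merge :: "('a \<Rightarrow> real) \<Rightarrow> 'a list \<Rightarrow> 'a list \<Rightarrow> 'a list" where
  "merge f [] ys = ys"
| "merge f xs [] = xs"
| "merge f (x # xs) (y # ys) =
     (if f y < f x then y # merge f (x # xs) ys else x # merge f xs (y # ys))"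

lemma merge_Nil2 [simp]: "merge f xs [] = xs"
  by (cases xs) auto

lemma mset_merge [simp]: "mset (merge f xs ys) = mset xs + mset ys"
  by (induction f xs ys rule: merge.induct) auto

lemma set_merge [simp]: "set (merge f xs ys) = set xs \<union> set ys"
  by (metis mset_merge set_mset_mset set_mset_union)

lemma map_merge: "map f (merge f xs ys) = merge id (map f xs) (map f ys)"
  by (induction f xs ys rule: merge.induct) auto

lemma sorted_merge: "sorted xs \<Longrightarrow> sorted ys \<Longrightarrow> sorted (merge id xs ys)"
  by (induction "id :: real \<Rightarrow> real" xs ys rule: merge.induct) fastforce+

text \<open>A sorted list is determined by its multiset. With \<open>sort\<close> in place of
  \<open>merge\<close>, positions can be analysed by counting.\<close>

lemma merge_eq_sort: "sorted xs \<Longrightarrow> sorted ys \<Longrightarrow> merge id xs ys = sort (xs @ ys)"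
  by (metis mset_append mset_merge mset_sort properties_for_sort sorted_merge)

text \<open>The first left segment has its own length so that one function serves both passes:
  \<open>k = w\<close> pairs up the blocks, while \<open>k = 0\<close> copies the first block and
  thereby shifts the pairing by \<open>w\<close>.\<close>

function merge_pass :: "('a \<Rightarrow> real) \<Rightarrow> nat \<Rightarrow> nat \<Rightarrow> 'a list \<Rightarrow> 'a list" where
  "merge_pass f k w xs =
     (if xs = [] \<or> w = 0 then xs
      else merge f (take k xs) (take w (drop k xs)) @ merge_pass f w w (drop (k + w) xs))"
  by auto
termination by (relation "Wellfounded.measure (\<lambda>(f, k, w, xs). length xs)") auto

declare merge_pass.simps [simp del]

lemma merge_pass_Nil [simp]: "merge_pass f k w [] = []"
  by (simp add: merge_pass.simps)

lemma mset_merge_pass [simp]: "mset (merge_pass f k w xs) = mset xs"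
proof (induction f k w xs rule: merge_pass.induct)
  case (1 f k w xs)
  have "mset xs = mset (take k xs @ take w (drop k xs) @ drop (k + w) xs)"
    by (metis add.commute append_take_drop_id drop_drop)
  with 1 show ?case by (subst merge_pass.simps) (auto simp: add.assoc)
qed

lemma set_merge_pass [simp]: "set (merge_pass f k w xs) = set xs"
  by (metis mset_merge_pass set_mset_mset)

text \<open>Block structure and locality concern the keys alone; this carries them over to lists of
  references.\<close>

lemma map_merge_pass: "map f (merge_pass f k w xs) = merge_pass id k w (map f xs)"
proof (induction f k w xs rule: merge_pass.induct)
  case (1 f k w xs)
  show ?case
  proof (cases "xs = [] \<or> w = 0")
    case False
    then show ?thesis using 1
      by (simp add: merge_pass.simps[of _ k] map_merge take_map drop_map id_def)
  qed (auto simp: merge_pass.simps[of _ k])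
qed

function sorted_blocks :: "nat \<Rightarrow> real list \<Rightarrow> bool" where
  "sorted_blocks w xs \<longleftrightarrow>
     (if xs = [] \<or> w = 0 then True else sorted (take w xs) \<and> sorted_blocks w (drop w xs))"
  by auto
termination by (relation "Wellfounded.measure (\<lambda>(w, xs). length xs)") auto

declare sorted_blocks.simps [simp del]

lemma sorted_blocks_Nil [simp]: "sorted_blocks w []"
  by (simp add: sorted_blocks.simps)

lemma sorted_blocks_1: "sorted_blocks 1 xs"
proof (induction xs)
  case (Cons x xs)
  then show ?case by (subst sorted_blocks.simps) simp
qed simp

lemma sorted_blocks_take: "sorted_blocks w xs \<Longrightarrow> 0 < w \<Longrightarrow> sorted (take w xs)"
  by (cases "xs = []") (auto simp: sorted_blocks.simps[of w xs])

lemma sorted_blocks_drop: "sorted_blocks w xs \<Longrightarrow> 0 < w \<Longrightarrow> sorted_blocks w (drop w xs)"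
  by (cases "xs = []") (auto simp: sorted_blocks.simps[of w xs])

lemma merge_pass_eq_sort:
  assumes "sorted (take k xs)" and "sorted (take w (drop k xs))" and "xs \<noteq> []" and "0 < w"
  shows "merge_pass id k w xs = sort (take (k + w) xs) @ merge_pass id w w (drop (k + w) xs)"
  using assms by (simp add: merge_pass.simps[of _ k] merge_eq_sort take_add)

lemma sorted_blocks_merge_pass:
  "sorted_blocks w xs \<Longrightarrow> 0 < w \<Longrightarrow> sorted_blocks (2 * w) (merge_pass id w w xs)"
proof (induction "length xs" arbitrary: xs rule: less_induct)
  case less
  show ?case
  proof (cases "xs = []")
    case False
    have "merge_pass id w w xs = sort (take (w + w) xs) @ merge_pass id w w (drop (w + w) xs)"
      using False less.prems sorted_blocks_take sorted_blocks_drop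
      by (intro merge_pass_eq_sort) blast+
    then have eq: "merge_pass id w w xs =
        sort (take (2 * w) xs) @ merge_pass id w w (drop (2 * w) xs)"
      by (simp only: mult_2)
    have IH: "sorted_blocks (2 * w) (merge_pass id w w (drop (2 * w) xs))"
    proof (rule less.hyps)
      show "sorted_blocks w (drop (2 * w) xs)"
        using sorted_blocks_drop[OF sorted_blocks_drop[of w xs]] less.prems
        by (simp only: drop_drop mult_2)
    qed (use False less.prems in auto)
    show ?thesis
    proof (cases "length xs \<le> 2 * w")
      case True
      then show ?thesis by (subst eq) (simp add: sorted_blocks.simps[of _ "sort xs"])
    next
      case False
      then show ?thesis using IH
        by (subst eq, subst sorted_blocks.simps) (simp add: min_def)
    qed
  qed simp
qed

definition local_order :: "nat \<Rightarrow> real list \<Rightarrow> bool" where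
  "local_order l xs \<longleftrightarrow> (\<forall>i j. i + l \<le> j \<longrightarrow> j < length xs \<longrightarrow> xs ! i \<le> xs ! j)"

lemma local_orderD: "local_order l xs \<Longrightarrow> i + l \<le> j \<Longrightarrow> j < length xs \<Longrightarrow> xs ! i \<le> xs ! j"
  by (simp add: local_order_def)

lemma local_order_drop: "local_order l xs \<Longrightarrow> local_order l (drop k xs)"
  by (auto simp: local_order_def)

lemma length_filter_sort: "length (filter P (sort xs)) = length (filter P xs)"
  by (metis mset_filter mset_sort size_mset)

text \<open>If the sorted entry at \<open>k\<close> were below \<open>v\<close>, at least
  \<open>Suc k\<close> entries would be, but only the \<open>q\<close> entries in front of position
  \<open>q\<close> can be.\<close>

lemma sort_nth_ge:
  fixes xs :: "real list"
  assumes ge: "\<And>k. q \<le> k \<Longrightarrow> k < length xs \<Longrightarrow> v \<le> xs ! k"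
    and k: "q \<le> k" "k < length xs"
  shows "v \<le> sort xs ! k"
proof (rule ccontr)
  assume "\<not> v \<le> sort xs ! k"
  then have less: "\<forall>x \<in> set (take (Suc k) (sort xs)). x < v"
  proof (intro ballI)
    fix x assume "x \<in> set (take (Suc k) (sort xs))"
    then obtain i where "x = sort xs ! i" "i \<le> k"
      by (auto simp: in_set_conv_nth less_Suc_eq_le)
    then have "x \<le> sort xs ! k" using k by (auto intro: sorted_nth_mono)
    with \<open>\<not> v \<le> sort xs ! k\<close> show "x < v" by simp
  qed
  have "Suc k = length (filter (\<lambda>x. x < v) (take (Suc k) (sort xs)))"
    using less k by (subst filter_True) auto
  also have "\<dots> \<le> length (filter (\<lambda>x. x < v) (take (Suc k) (sort xs) @ drop (Suc k) (sort xs)))"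
    by (simp only: filter_append length_append)
  also have "\<dots> = length (filter (\<lambda>x. x < v) (take q xs @ drop q xs))"
    by (simp only: append_take_drop_id length_filter_sort)
  also have "\<dots> = length (filter (\<lambda>x. x < v) (take q xs))"
    using ge unfolding filter_append
    by (auto simp: filter_empty_conv in_set_conv_nth not_less)
  also have "\<dots> \<le> q"
    by (rule le_trans[OF length_filter_le]) simp
  finally show False using k by simp
qed

text \<open>The dual count: entries above \<open>v\<close> can only stand behind position
  \<open>q\<close>, which leaves fewer than the \<open>length xs - k\<close> entries from
  \<open>k\<close> on.\<close>

lemma sort_nth_le:
  fixes xs :: "real list"
  assumes le: "\<And>k. k \<le> q \<Longrightarrow> xs ! k \<le> v"
    and k: "k \<le> q" "q < length xs"
  shows "sort xs ! k \<le> v"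
proof (rule ccontr)
  assume "\<not> sort xs ! k \<le> v"
  then have gr: "\<forall>x \<in> set (drop k (sort xs)). v < x"
  proof (intro ballI)
    fix x assume "x \<in> set (drop k (sort xs))"
    then obtain i where "x = sort xs ! (k + i)" "k + i < length xs"
      by (auto simp: in_set_conv_nth)
    then have "sort xs ! k \<le> x" by (auto intro: sorted_nth_mono)
    with \<open>\<not> sort xs ! k \<le> v\<close> show "v < x" by simp
  qed
  have "length xs - k = length (filter (\<lambda>x. v < x) (drop k (sort xs)))"
    using gr by (subst filter_True) auto
  also have "\<dots> \<le> length (filter (\<lambda>x. v < x) (take k (sort xs) @ drop k (sort xs)))"
    by (simp only: filter_append length_append)
  also have "\<dots> = length (filter (\<lambda>x. v < x) (take (Suc q) xs @ drop (Suc q) xs))"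
    by (simp only: append_take_drop_id length_filter_sort)
  also have "\<dots> = length (filter (\<lambda>x. v < x) (drop (Suc q) xs))"
    using le unfolding filter_append
    by (auto simp: filter_empty_conv in_set_conv_nth not_less less_Suc_eq_le)
  also have "\<dots> \<le> length xs - Suc q"
    by (rule le_trans[OF length_filter_le]) simp
  finally show False using k by simp
qed

text \<open>Only pairs with one position inside \<open>bs\<close> are delicate. For \<open>i\<close>
  outside and \<open>j\<close> inside, locality puts all entries of \<open>bs\<close> from
  \<open>j\<close> on above the entry at \<open>i\<close>, and by counting this survives sorting;
  the other case is dual.\<close>

lemma local_order_sort_segment:
  assumes loc: "local_order l (as @ bs @ cs)"
  shows "local_order l (as @ sort bs @ cs)"
  unfolding local_order_def
proof (intro allI impI)
  fix i j
  let ?xs = "as @ bs @ cs" and ?ys = "as @ sort bs @ cs"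
  let ?a = "length as" and ?b = "length bs"
  assume ij: "i + l \<le> j" "j < length ?ys"
  have outside: "?ys ! k = ?xs ! k" if "k < ?a \<or> ?a + ?b \<le> k" for k
    using that by (auto simp: nth_append)
  have inside: "?ys ! k = sort bs ! (k - ?a)" if "?a \<le> k" "k < ?a + ?b" for k
    using that by (auto simp: nth_append)
  have bs: "bs ! k = ?xs ! (?a + k)" if "k < ?b" for k
    using that by (auto simp: nth_append)
  consider "i < ?a \<or> ?a + ?b \<le> i" "j < ?a \<or> ?a + ?b \<le> j"
    | "i < ?a \<or> ?a + ?b \<le> i" "?a \<le> j" "j < ?a + ?b"
    | "?a \<le> i" "i < ?a + ?b" "j < ?a \<or> ?a + ?b \<le> j"
    | "?a \<le> i" "i < ?a + ?b" "?a \<le> j" "j < ?a + ?b"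
    by linarith
  then show "?ys ! i \<le> ?ys ! j"
  proof cases
    case 1
    then show ?thesis using local_orderD[OF loc ij(1)] ij(2) outside by auto
  next
    case 2
    have "?xs ! i \<le> sort bs ! (j - ?a)"
    proof (rule sort_nth_ge)
      fix k assume "j - ?a \<le> k" "k < ?b"
      then show "?xs ! i \<le> bs ! k"
        using 2 ij unfolding bs[OF \<open>k < ?b\<close>] by (intro local_orderD[OF loc]) auto
    qed (use 2 in auto)
    then show ?thesis using 2 outside inside by simp
  next
    case 3
    have "sort bs ! (i - ?a) \<le> ?xs ! j"
    proof (rule sort_nth_le[where q = "i - ?a"])
      fix k assume "k \<le> i - ?a"
      then have "k < ?b" using 3 by simp
      then show "bs ! k \<le> ?xs ! j"
        using 3 ij \<open>k \<le> i - ?a\<close> unfolding bs[OF \<open>k < ?b\<close>] by (intro local_orderD[OF loc]) auto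
    qed (use 3 in auto)
    then show ?thesis using 3 outside inside by simp
  next
    case 4
    then show ?thesis using ij inside by (auto intro!: sorted_nth_mono)
  qed
qed

text \<open>On sorted blocks each merge sorts one segment in place. The prefix \<open>as\<close>
  collects the segments already treated, so that every step is an instance of
  \<open>local_order_sort_segment\<close>.\<close>

lemma local_order_merge_pass:
  "sorted_blocks w xs \<Longrightarrow> 0 < w \<Longrightarrow> local_order l (as @ xs) \<Longrightarrow>
   local_order l (as @ merge_pass id w w xs)"
proof (induction "length xs" arbitrary: xs as rule: less_induct)
  case less
  show ?case
  proof (cases "xs = []")
    case False
    have eq: "merge_pass id w w xs =
        sort (take (w + w) xs) @ merge_pass id w w (drop (w + w) xs)"
      using False less.prems sorted_blocks_take sorted_blocks_drop
      by (intro merge_pass_eq_sort) blast+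
    have "local_order l (as @ take (w + w) xs @ drop (w + w) xs)"
      using less.prems by simp
    then have loc: "local_order l ((as @ sort (take (w + w) xs)) @ drop (w + w) xs)"
      using local_order_sort_segment by (metis append.assoc)
    have "local_order l ((as @ sort (take (w + w) xs)) @ merge_pass id w w (drop (w + w) xs))"
    proof (rule less.hyps[OF _ _ _ loc])
      show "sorted_blocks w (drop (w + w) xs)"
        using sorted_blocks_drop[OF sorted_blocks_drop[of w xs]] less.prems
        by (simp only: drop_drop)
    qed (use False less.prems in auto)
    then show ?thesis by (simp add: eq)
  qed (use less.prems in simp)
qed

text \<open>The element at position \<open>k + w - 1\<close> separates the first merged segment from the rest: against
  positions at distance at least \<open>w\<close> by locality, against nearer ones because they belong
  to the same sorted block of length \<open>2 * w\<close>.\<close>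

lemma sorted_merge_pass:
  "sorted (take k xs) \<Longrightarrow> sorted_blocks (2 * w) (drop k xs) \<Longrightarrow> local_order w xs \<Longrightarrow> 0 < w \<Longrightarrow>
   sorted (merge_pass id k w xs)"
proof (induction "length xs" arbitrary: k xs rule: less_induct)
  case less
  show ?case
  proof (cases "xs = []")
    case False
    have block: "sorted (take (2 * w) (drop k xs))"
      using less.prems sorted_blocks_take[of "2 * w" "drop k xs"] by simp
    have block_nth: "xs ! i \<le> xs ! j" if "k \<le> i" "i \<le> j" "j < k + 2 * w" "j < length xs" for i j
    proof -
      have "take (2 * w) (drop k xs) ! (i - k) \<le> take (2 * w) (drop k xs) ! (j - k)"
        using that by (intro sorted_nth_mono[OF block]) auto
      then show ?thesis using that by simp
    qed
    have "take w (take (2 * w) (drop k xs)) = take w (drop k xs)" by simp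
    then have "sorted (take w (drop k xs))"
      using block by (metis sorted_wrt_take)
    then have eq: "merge_pass id k w xs =
        sort (take (k + w) xs) @ merge_pass id w w (drop (k + w) xs)"
      using less.prems False by (intro merge_pass_eq_sort) auto
    \<comment> \<open>The rest starts with the second half of the block just cut, and whole blocks
      of length \<open>2 * w\<close> follow it. So the hypotheses hold again with \<open>w\<close>
      as the length of the first left segment.\<close>
    have "take w (drop (k + w) xs) = drop w (take (2 * w) (drop k xs))"
      by (simp add: drop_take add.commute)
    then have "sorted (take w (drop (k + w) xs))"
      using block by (metis sorted_wrt_drop)
    moreover have "drop w (drop (k + w) xs) = drop (2 * w) (drop k xs)"
      unfolding drop_drop by (rule arg_cong2[where f = drop]) simp_all
    then have "sorted_blocks (2 * w) (drop w (drop (k + w) xs))"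
      using less.prems sorted_blocks_drop[of "2 * w" "drop k xs"] by simp
    ultimately have rest: "sorted (merge_pass id w w (drop (k + w) xs))"
      using less False local_order_drop[of w xs "k + w"] by (intro less.hyps) auto
    have "x \<le> y" if x: "x \<in> set (take (k + w) xs)" and y: "y \<in> set (drop (k + w) xs)" for x y
    proof -
      from x obtain i where i: "x = xs ! i" "i < k + w" "i < length xs"
        by (auto simp: in_set_conv_nth)
      from y obtain j where j: "y = xs ! j" "k + w \<le> j" "j < length xs"
        by (auto simp: in_set_conv_nth)
      let ?p = "k + w - 1"
      have "xs ! i \<le> xs ! ?p"
      proof (cases "i < k")
        case True
        then show ?thesis using j less.prems by (intro local_orderD[of w]) auto
      next
        case False
        then show ?thesis using i j less.prems by (intro block_nth) auto
      qed
      also have "xs ! ?p \<le> xs ! j"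
      proof (cases "j < k + 2 * w")
        case True
        then show ?thesis using j less.prems by (intro block_nth) auto
      next
        case False
        then show ?thesis using j less.prems by (intro local_orderD[of w]) auto
      qed
      finally show ?thesis using i j by simp
    qed
    with rest show ?thesis by (subst eq) (auto simp: sorted_append)
  qed simp
qed

section \<open>Inversions in smooth supersequences\<close>

lemma unit_interval_bounds:
  assumes "unit_interval J" "x \<in> J"
  shows "Inf J \<le> x" "x \<le> Sup J"
  using assms
  by (auto simp: unit_interval_def bounded_interval_def
      intro!: cInf_lower cSup_upper bounded_imp_bdd_above bounded_imp_bdd_below)

text \<open>The interval need not contain its endpoint, so arguments about endpoints go through
  nearby points.\<close>

lemma unit_interval_near_Sup:
  assumes "unit_interval J" "0 < e"
  obtains x where "x \<in> J" "Sup J - e < x"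
  using assms less_cSup_iff[of J "Sup J - e"]
  by (auto simp: unit_interval_def bounded_interval_def bounded_imp_bdd_above)

lemma unit_interval_near_Inf:
  assumes "unit_interval J" "0 < e"
  obtains x where "x \<in> J" "x < Inf J + e"
  using assms cInf_less_iff[of J "Inf J + e"]
  by (auto simp: unit_interval_def bounded_interval_def bounded_imp_bdd_below)

text \<open>Length 1 excludes a singleton, so a whole segment between \<open>x\<close> and some
  other point lies in \<open>J\<close>. This gives room to move a point while avoiding finitely many
  values.\<close>

lemma unit_interval_infinite_near:
  assumes J: "unit_interval J" and x: "x \<in> J" and e: "0 < e"
  shows "infinite {y \<in> J. \<bar>y - x\<bar> < e}"
proof -
  have "J \<noteq> {x}"
    using J by (auto simp: unit_interval_def interval_length_def)
  with x obtain y where y: "y \<in> J" "y \<noteq> x" by blast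
  define a b where "a = max (min x y) (x - e)" and "b = min (max x y) (x + e)"
  have "a < b" using y e by (auto simp: a_def b_def)
  moreover have "{a<..<b} \<subseteq> {y \<in> J. \<bar>y - x\<bar> < e}"
  proof
    fix z assume z: "z \<in> {a<..<b}"
    then have "min x y \<le> z" "z \<le> max x y" "\<bar>z - x\<bar> < e"
      by (auto simp: a_def b_def)
    moreover have "z \<in> J"
      using J x y calculation mem_is_interval_1_I[of J x y z] mem_is_interval_1_I[of J y x z]
      by (auto simp: unit_interval_def bounded_interval_def min_def max_def split: if_splits)
    ultimately show "z \<in> {y \<in> J. \<bar>y - x\<bar> < e}" by simp
  qed
  ultimately show ?thesis
    using infinite_super infinite_Ioo by blast
qed

lemma realization_iff_list_all2: "realization R P \<longleftrightarrow> list_all2 (\<lambda>J x. x \<in> J) R P"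
  by (auto simp: realization_def list_all2_conv_all_nth)

text \<open>The points are chosen one at a time, each avoiding the finitely many values already
  taken.\<close>

lemma realization_perturb:
  assumes "\<forall>J \<in> set R. unit_interval J" and "realization R P" and e: "0 < e"
  obtains P' where "realization R P'" and "distinct P'"
    and "\<And>i. i < length R \<Longrightarrow> \<bar>P' ! i - P ! i\<bar> < e"
proof -
  have "list_all2 (\<lambda>J x. x \<in> J) R P"
    using assms(2) by (simp add: realization_iff_list_all2)
  then have "\<exists>P'. list_all2 (\<lambda>J x. x \<in> J) R P' \<and> distinct P' \<and>
      list_all2 (\<lambda>x y. \<bar>y - x\<bar> < e) P P'"
    using assms(1)
  proof (induction rule: list_all2_induct)
    case (Cons J R x P)
    then obtain P' where P': "list_all2 (\<lambda>J x. x \<in> J) R P'" "distinct P'"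
        "list_all2 (\<lambda>x y. \<bar>y - x\<bar> < e) P P'" by auto
    have "infinite ({y \<in> J. \<bar>y - x\<bar> < e} - set P')"
      using Cons e by (intro Diff_infinite_finite unit_interval_infinite_near) auto
    then obtain y where "y \<in> {y \<in> J. \<bar>y - x\<bar> < e} - set P'"
      using infinite_imp_nonempty by blast
    with P' show ?case by (intro exI[of _ "y # P'"]) auto
  qed simp
  then show thesis
    using that assms(2) by (auto simp: realization_iff_list_all2 list_all2_conv_all_nth)
qed

lemma set_sorting_supersequence:
  assumes "sorting_supersequence R \<Xi>" and "realization R P"
  shows "set \<Xi> = {..<length R}"
proof -
  from assms obtain \<sigma> where "sorted_order P \<sigma>" "subseq \<sigma> \<Xi>"
    unfolding sorting_supersequence_def by blast
  then have "set \<sigma> = {..<length R}" "set \<sigma> \<subseteq> set \<Xi>"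
    using assms(2) by (auto simp: sorted_order_def realization_def subseq_conv_nths dest: in_set_nthsD)
  then show ?thesis using assms(1) by (auto simp: sorting_supersequence_def)
qed

text \<open>The packing property counts values, not points; perturbing the realization
  makes its points distinct.\<close>

lemma card_points_in_window:
  assumes U: "\<forall>J \<in> set R. unit_interval J" and S: "smooth_supersequence \<alpha> \<beta> R \<Xi>"
    and P: "realization R P" and \<alpha>: "1 \<le> \<alpha>"
  shows "real (card {i. i < length R \<and> c \<le> P ! i \<and> P ! i \<le> c + \<alpha>}) \<le> \<beta> * \<alpha>"
    (is "real (card ?S) \<le> _")
proof -
  have eps: "real (card ?S) \<le> \<beta> * (\<alpha> + 2 * e)" if e: "0 < e" for e
  proof -
    obtain P' where P': "realization R P'" "distinct P'"
        "\<And>i. i < length R \<Longrightarrow> \<bar>P' ! i - P ! i\<bar> < e"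
      using realization_perturb[OF U P e] by blast
    \<comment> \<open>Widening by \<open>e\<close> on both sides catches the perturbed points, and
      it makes the length exceed 1 even if \<alpha> is 1, as the packing property requires.\<close>
    let ?J = "{c - e .. c + \<alpha> + e}"
    have J: "bounded_interval ?J" and len: "interval_length ?J = \<alpha> + 2 * e"
      using \<alpha> e by (auto simp: bounded_interval_def interval_length_def is_interval_cc)
    have "smooth \<alpha> \<beta> (map ((!) P') \<Xi>)"
      using S P'(1) by (simp add: smooth_supersequence_def)
    then have "real (card (set (map ((!) P') \<Xi>) \<inter> ?J)) \<le> \<beta> * interval_length ?J"
      using J \<alpha> e len unfolding smooth_def by (metis add_le_less_mono add.right_neutral
          mult_pos_pos zero_less_numeral)
    then have "real (card (set (map ((!) P') \<Xi>) \<inter> ?J)) \<le> \<beta> * (\<alpha> + 2 * e)"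
      by (simp only: len)
    moreover have "card ?S \<le> card (set (map ((!) P') \<Xi>) \<inter> ?J)"
    proof (rule card_inj_on_le)
      show "inj_on ((!) P') ?S"
        using P' by (auto simp: inj_on_def realization_def nth_eq_iff_index_eq)
      show "(!) P' ` ?S \<subseteq> set (map ((!) P') \<Xi>) \<inter> ?J"
        using set_sorting_supersequence[of R \<Xi> P] S P P'(3)
        by (force simp: smooth_supersequence_def)
    qed simp
    ultimately show ?thesis by linarith
  qed
  show ?thesis
  \<comment> \<open>For nonpositive \<beta> the widening only lowers the bound; otherwise
    \<open>e\<close> is chosen so that the surplus \<open>2 * e * \<beta>\<close> equals a given
    \<open>d\<close>.\<close>
  proof (cases "\<beta> \<le> 0")
    case True
    then show ?thesis using eps[of 1] by (simp add: algebra_simps)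
  next
    case False
    show ?thesis
    proof (rule field_le_epsilon)
      fix d :: real assume "0 < d"
      then have "real (card ?S) \<le> \<beta> * (\<alpha> + 2 * (d / (2 * \<beta>)))"
        using False by (intro eps) simp
      also have "\<dots> = \<beta> * \<alpha> + d" using False by (simp add: distrib_left)
      finally show "real (card ?S) \<le> \<beta> * \<alpha> + d" .
    qed
  qed
qed

lemma subseq_remdups: "subseq (remdups xs) xs"
  by (induction xs) auto

lemma subseq_pair_nth:
  "i < j \<Longrightarrow> j < length xs \<Longrightarrow> subseq [xs ! i, xs ! j] xs"
proof (induction xs arbitrary: i j)
  case (Cons x xs)
  then obtain j' where j: "j = Suc j'" by (cases j) auto
  show ?case
  proof (cases i)
    case 0
    then show ?thesis using Cons.prems j by (auto simp: subseq_singleton_left)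
  next
    case (Suc i')
    then show ?thesis using Cons j by (auto simp: subseq_singleton_left)
  qed
qed simp

lemma subseq_pairE:
  assumes "subseq [x, y] xs"
  obtains i j where "i < j" "j < length xs" "xs ! i = x" "xs ! j = y"
proof -
  have "\<exists>i j. i < j \<and> j < length xs \<and> xs ! i = x \<and> xs ! j = y"
    using assms
  proof (induction xs rule: list.induct)
    case (Cons z xs)
    show ?case
    proof (cases "subseq [x, y] xs")
      case True
      with Cons.IH obtain i j where "i < j \<and> j < length xs \<and> xs ! i = x \<and> xs ! j = y" by blast
      then show ?thesis by (intro exI[of _ "Suc i"] exI[of _ "Suc j"]) simp
    next
      case False
      then have "z = x" "y \<in> set xs"
        using Cons.prems by (auto simp: subseq_singleton_left split: if_splits)
      then obtain j where "j < length xs" "xs ! j = y" by (auto simp: in_set_conv_nth)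
      then show ?thesis using \<open>z = x\<close> by (intro exI[of _ 0] exI[of _ "Suc j"]) simp
    qed
  qed simp
  then show thesis using that by blast
qed

lemma smooth_supersequence_distance:
  assumes "smooth_supersequence \<alpha> \<beta> R \<Xi>" and "realization R P"
    and "subseq [u, v] \<Xi>" and "P ! v < P ! u"
  shows "P ! u - P ! v \<le> \<alpha>"
proof -
  obtain i j where "i < j" "j < length \<Xi>" "\<Xi> ! i = u" "\<Xi> ! j = v"
    using assms(3) by (rule subseq_pairE)
  moreover have "smooth \<alpha> \<beta> (map ((!) P) \<Xi>)"
    using assms(1,2) by (simp add: smooth_supersequence_def)
  ultimately show ?thesis
    using assms(4) unfolding smooth_def by fastforce
qed

text \<open>Smoothness quantifies over all realizations: push the point of \<open>u\<close> towards
  the top of its interval and that of \<open>v\<close> towards the bottom, keep the others, and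
  apply the distance property.\<close>

lemma smooth_supersequence_endpoints:
  assumes U: "\<forall>J \<in> set R. unit_interval J" and S: "smooth_supersequence \<alpha> \<beta> R \<Xi>"
    and P: "realization R P" and uv: "u < length R" "v < length R" "u \<noteq> v" "subseq [u, v] \<Xi>"
    and pos: "Inf (R ! v) < Sup (R ! u)"
  shows "Sup (R ! u) - Inf (R ! v) \<le> \<alpha>"
proof (rule ccontr)
  assume gr: "\<not> ?thesis"
  \<comment> \<open>Subtracting \<open>max 0 \<alpha>\<close> makes the new points both inverted and
    too far apart; the distance property says nothing about points in order.\<close>
  define e where "e = Sup (R ! u) - Inf (R ! v) - max 0 \<alpha>"
  have e: "0 < e" using pos gr by (auto simp: e_def)
  obtain x where x: "x \<in> R ! u" "Sup (R ! u) - e / 2 < x"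
    using unit_interval_near_Sup[of "R ! u" "e / 2"] U uv e by auto
  obtain y where y: "y \<in> R ! v" "y < Inf (R ! v) + e / 2"
    using unit_interval_near_Inf[of "R ! v" "e / 2"] U uv e by auto
  let ?P = "P[u := x, v := y]"
  have "realization R ?P"
    using P x(1) y(1) uv by (auto simp: realization_def nth_list_update)
  moreover have "?P ! u = x" "?P ! v = y" using P uv by (auto simp: realization_def)
  moreover have "x - y > max 0 \<alpha>" using x y by (simp add: e_def field_simps)
  ultimately show False
    using smooth_supersequence_distance[OF S, of ?P u v] uv by auto
qed

lemma subseq_sorted_order:
  assumes "sorted_order P \<sigma>" and "u < length P" "v < length P" "P ! v < P ! u"
  shows "subseq [v, u] \<sigma>"
proof -
  from assms obtain i j where ij: "i < length \<sigma>" "j < length \<sigma>" "\<sigma> ! i = v" "\<sigma> ! j = u"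
    unfolding sorted_order_def by (metis in_set_conv_nth lessThan_iff)
  have "i < j"
  proof (rule ccontr)
    assume "\<not> i < j"
    then have "map ((!) P) \<sigma> ! j \<le> map ((!) P) \<sigma> ! i"
      using assms(1) ij by (intro sorted_nth_mono) (auto simp: sorted_order_def)
    then show False using ij assms by simp
  qed
  then show ?thesis using subseq_pair_nth[of i j \<sigma>] ij by simp
qed

text \<open>If \<open>\<Xi>\<close> is out of order on two points, then both orders of their intervals occur in
  \<open>\<Xi>\<close>. The two resulting distance bounds \<open>Sup R\<^sub>u - Inf R\<^sub>v\<close> and \<open>Sup R\<^sub>v - Inf R\<^sub>u\<close> add up to 2.\<close>

lemma smooth_supersequence_alpha_ge_1:
  assumes U: "\<forall>J \<in> set R. unit_interval J" and S: "smooth_supersequence \<alpha> \<beta> R \<Xi>"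
    and P: "realization R P" and uv: "u < length R" "v < length R" "subseq [u, v] \<Xi>"
    and inv: "P ! v < P ! u"
  shows "1 \<le> \<alpha>"
proof -
  have ne: "u \<noteq> v" using inv by auto
  have len: "Sup (R ! u) = Inf (R ! u) + 1" "Sup (R ! v) = Inf (R ! v) + 1"
    using U uv by (auto simp: unit_interval_def interval_length_def algebra_simps)
  have "Inf (R ! v) \<le> P ! v" "P ! u \<le> Sup (R ! u)"
    using U P uv by (auto simp: realization_def intro: unit_interval_bounds)
  then have "Sup (R ! u) - Inf (R ! v) \<le> \<alpha>"
    using inv ne by (intro smooth_supersequence_endpoints[OF U S P] uv) auto
  \<comment> \<open>If the guard fails, the interval of \<open>u\<close> starts no earlier than that
    of \<open>v\<close> ends, and the first bound alone gives
    \<open>2 \<le> \<alpha>\<close>.\<close>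
  moreover have "Sup (R ! v) - Inf (R ! u) \<le> \<alpha>" if "Inf (R ! u) < Sup (R ! v)"
  proof -
    from S P obtain \<sigma> where "sorted_order P \<sigma>" "subseq \<sigma> \<Xi>"
      unfolding smooth_supersequence_def sorting_supersequence_def by blast
    moreover have "length P = length R" using P by (simp add: realization_def)
    ultimately have "subseq [v, u] \<Xi>"
      using subseq_sorted_order[of P \<sigma> u v] uv inv subseq_order.order_trans by metis
    then show ?thesis
      using that ne by (intro smooth_supersequence_endpoints[OF U S P] uv) auto
  qed
  ultimately show ?thesis using len by linarith
qed

text \<open>An entry between the two is either below the point at \<open>i\<close>, and then forms
  an inversion with it, or above the point at \<open>j\<close>, and then forms one with that. The
  distance property puts it into a window below the former or above the latter.\<close>

lemma inversion_distance:
  assumes U: "\<forall>J \<in> set R. unit_interval J" and S: "smooth_supersequence \<alpha> \<beta> R \<Xi>"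
    and P: "realization R P" and ij: "i < j" "j < length (remdups \<Xi>)"
    and inv: "P ! (remdups \<Xi> ! j) < P ! (remdups \<Xi> ! i)"
  shows "real (j - i) + 1 \<le> 2 * (\<alpha> * \<beta>)"
proof -
  let ?Y = "remdups \<Xi>"
  let ?W = "\<lambda>c. {k. k < length R \<and> c \<le> P ! k \<and> P ! k \<le> c + \<alpha>}"
  have bound: "?Y ! k < length R" if "k < length ?Y" for k
    using that nth_mem[OF that] set_sorting_supersequence[of R \<Xi> P] S P
    by (auto simp: smooth_supersequence_def)
  have sub: "subseq [?Y ! k, ?Y ! l] \<Xi>" if "k < l" "l < length ?Y" for k l
    using subseq_pair_nth[OF that] subseq_remdups subseq_order.order_trans by blast
  have \<alpha>: "1 \<le> \<alpha>"
    using ij inv bound sub by (intro smooth_supersequence_alpha_ge_1[OF U S P]) auto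
  have window: "?Y ! k \<in> ?W (P ! (?Y ! i) - \<alpha>) \<union> ?W (P ! (?Y ! j))" if k: "i \<le> k" "k \<le> j" for k
  proof (cases "P ! (?Y ! k) < P ! (?Y ! i)")
    case True
    then have "i < k" using k by (cases "i = k") auto
    then have "P ! (?Y ! i) - P ! (?Y ! k) \<le> \<alpha>"
      using True k ij by (intro smooth_supersequence_distance[OF S P] sub) auto
    then show ?thesis using True k ij bound[of k] \<alpha> by auto
  next
    case False
    then have gr: "P ! (?Y ! j) < P ! (?Y ! k)" using inv by simp
    then have "k < j" using k by (cases "k = j") auto
    then have "P ! (?Y ! k) - P ! (?Y ! j) \<le> \<alpha>"
      using gr k ij by (intro smooth_supersequence_distance[OF S P] sub) auto
    then show ?thesis using gr k ij bound[of k] by auto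
  qed
  \<comment> \<open>Without repetitions the positions from \<open>i\<close> to \<open>j\<close> name
    different intervals.\<close>
  have "j - i + 1 = card ((!) ?Y ` {i..j})"
    using ij by (subst card_image) (auto simp: inj_on_def nth_eq_iff_index_eq)
  also have "\<dots> \<le> card (?W (P ! (?Y ! i) - \<alpha>) \<union> ?W (P ! (?Y ! j)))"
  proof (rule card_mono)
    show "(!) ?Y ` {i..j} \<subseteq> ?W (P ! (?Y ! i) - \<alpha>) \<union> ?W (P ! (?Y ! j))"
      by (intro image_subsetI window) simp_all
  qed simp
  also have "\<dots> \<le> card (?W (P ! (?Y ! i) - \<alpha>)) + card (?W (P ! (?Y ! j)))"
    by (rule card_Un_le)
  finally show ?thesis
    using card_points_in_window[OF U S P \<alpha>, of "P ! (?Y ! i) - \<alpha>"]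
      card_points_in_window[OF U S P \<alpha>, of "P ! (?Y ! j)"]
    by (simp add: mult.commute)
qed

lemma local_order_remdups:
  assumes U: "\<forall>J \<in> set R. unit_interval J" and S: "smooth_supersequence \<alpha> \<beta> R \<Xi>"
    and P: "realization R P"
  obtains e where "local_order (2 ^ e) (map ((!) P) (remdups \<Xi>))"
    and "real e + 1 \<le> 4 * log 2 (max 2 (\<alpha> * \<beta>))"
proof (cases "local_order 1 (map ((!) P) (remdups \<Xi>))")
  \<comment> \<open>The list is sorted and \<open>e = 0\<close> serves; \<open>max 2\<close> alone
    makes the logarithm at least 1.\<close>
  case True
  have "1 \<le> log 2 (max 2 (\<alpha> * \<beta>))" by (subst le_log_iff) auto
  then have "real 0 + 1 \<le> 4 * log 2 (max 2 (\<alpha> * \<beta>))" by linarith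
  then show thesis by (rule that[rotated]) (use True in simp)
next
  case False
  then obtain i0 j0 where "i0 < j0" "j0 < length (remdups \<Xi>)"
      "P ! (remdups \<Xi> ! j0) < P ! (remdups \<Xi> ! i0)"
    by (auto simp: local_order_def Suc_le_eq not_le)
  \<comment> \<open>An inversion spans at least two positions, so
    \<open>2 \<le> 2 * (\<alpha> * \<beta>)\<close>.\<close>
  from inversion_distance[OF U S P this] this(1) have ab: "1 \<le> \<alpha> * \<beta>"
    by simp
  define e where "e = nat \<lceil>log 2 (2 * (\<alpha> * \<beta>))\<rceil>"
  have log: "log 2 (2 * (\<alpha> * \<beta>)) = 1 + log 2 (\<alpha> * \<beta>)"
    using ab by (subst log_mult) auto
  have "0 \<le> log 2 (\<alpha> * \<beta>)" using ab by simp
  then have e: "log 2 (2 * (\<alpha> * \<beta>)) \<le> real e" "real e \<le> log 2 (2 * (\<alpha> * \<beta>)) + 1"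
    using log unfolding e_def by linarith+
  have "2 * (\<alpha> * \<beta>) = 2 powr log 2 (2 * (\<alpha> * \<beta>))" using ab by simp
  also have "\<dots> \<le> 2 powr real e" using e by (intro powr_mono) auto
  finally have pow: "2 * (\<alpha> * \<beta>) \<le> 2 ^ e" by (simp add: powr_realpow)
  have "P ! (remdups \<Xi> ! i) \<le> P ! (remdups \<Xi> ! j)"
    if "i + 2 ^ e \<le> j" "j < length (remdups \<Xi>)" for i j
  proof (rule ccontr)
    assume "\<not> ?thesis"
    moreover have "i < j" using that(1) by (metis add_leD1 add_gr_0 le_neq_implies_less
        less_add_same_cancel1 not_le zero_less_numeral zero_less_power)
    ultimately have "real (j - i) + 1 \<le> 2 ^ e"
      using inversion_distance[OF U S P \<open>i < j\<close> that(2)] pow by simp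
    then have "real (j - i + 1) \<le> real (2 ^ e)" by simp
    then have "j - i + 1 \<le> 2 ^ e" by (simp only: of_nat_le_iff)
    then show False using that(1) by simp
  qed
  then have "local_order (2 ^ e) (map ((!) P) (remdups \<Xi>))"
    by (auto simp: local_order_def)
  \<comment> \<open>Doubling and rounding up add at most 1 each to the logarithm, so
    \<open>e + 1\<close> exceeds it by at most 3. As the logarithm of the maximum is at least 1, the
    factor 4 suffices.\<close>
  moreover have "real e + 1 \<le> 4 * log 2 (max 2 (\<alpha> * \<beta>))"
  proof -
    have "1 \<le> log 2 (max 2 (\<alpha> * \<beta>))" by (subst le_log_iff) auto
    moreover have "log 2 (\<alpha> * \<beta>) \<le> log 2 (max 2 (\<alpha> * \<beta>))" using ab by simp
    ultimately show ?thesis using e(2) log by linarith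
  qed
  ultimately show thesis by (rule that)
qed

section \<open>The sorting program\<close>

definition seg :: "(nat \<Rightarrow> 'a) \<Rightarrow> nat \<Rightarrow> nat \<Rightarrow> 'a list" where
  "seg f a b = map f [a..<b]"

lemma length_seg [simp]: "length (seg f a b) = b - a"
  by (simp add: seg_def)

lemma seg_empty [simp]: "b \<le> a \<Longrightarrow> seg f a b = []"
  by (simp add: seg_def)

lemma seg_eq_Nil_iff [simp]: "seg f a b = [] \<longleftrightarrow> b \<le> a"
  by (auto simp: seg_def)

lemma seg_Cons: "a < b \<Longrightarrow> seg f a b = f a # seg f (Suc a) b"
  by (simp add: seg_def upt_conv_Cons)

lemma seg_snoc: "a \<le> b \<Longrightarrow> seg f a (Suc b) = seg f a b @ [f b]"
  by (simp add: seg_def)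

lemma seg_cong: "(\<And>k. a \<le> k \<Longrightarrow> k < b \<Longrightarrow> f k = g k) \<Longrightarrow> seg f a b = seg g a b"
  by (simp add: seg_def)

lemma seg_append: "a \<le> b \<Longrightarrow> b \<le> c \<Longrightarrow> seg f a b @ seg f b c = seg f a c"
  unfolding seg_def by (metis le_add_diff_inverse map_append upt_add_eq_append)

lemma seg_upd [simp]: "k < a \<or> b \<le> k \<Longrightarrow> seg (f(k := v)) a b = seg f a b"
  by (auto intro: seg_cong)

lemma take_seg: "take k (seg f a b) = seg f a (min (a + k) b)"
proof (cases "a + k \<le> b")
  case True
  then show ?thesis by (simp add: seg_def take_map min_def)
qed (simp add: min_def)

lemma drop_seg: "drop k (seg f a b) = seg f (a + k) b"
  by (simp add: seg_def drop_map)

text \<open>\<open>take\<close> and \<open>drop\<close> clip silently at the end of the list. The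
  program clips explicitly, and \<open>mid\<close> and \<open>hi\<close> are the values it puts into
  registers 10 and 11.\<close>

lemma merge_pass_seg:
  assumes "i < e" "0 < w" "mid = min (i + k) e" "hi = min (mid + w) e"
  shows "merge_pass f k w (seg g i e) =
    merge f (seg g i mid) (seg g mid hi) @ merge_pass f w w (seg g hi e)"
proof -
  have "seg g (i + k) (min (i + k + w) e) = seg g mid hi"
    using assms by (cases "i + k \<le> e") auto
  moreover have "seg g (i + (k + w)) e = seg g hi e"
    using assms by (cases "i + k + w \<le> e") (auto simp: min_def add.assoc)
  ultimately show ?thesis
    using assms by (subst merge_pass.simps) (simp add: take_seg drop_seg)
qed

text \<open>Integer registers: 0 and 1 hold \<open>n\<close> and the length of \<open>\<Xi>\<close>; 2 and 3 the constants 0 and 1;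
  4, 5 and 6 the start addresses of three arrays of length \<open>n\<close>; 7 the block length; 8 tells whether
  the third array is unsorted; 9 the end of the current array; 10 and 11 the ends of the two
  segments being merged; 12 the end of their output; 13 the length of the next left segment;
  14, 15 and 16 the two reading positions and the writing position; the others are temporary.
  Thus registers below 14 are constant during a merge, and those below 9 during a pass.\<close>

definition take_left :: com where
  "take_left = Do [ILoad 17 14, IAdd 14 14 3]"

definition take_right :: com where
  "take_right = Do [ILoad 17 15, IAdd 15 15 3]"

text \<open>One loop over the output cells also handles an exhausted input, so the time per cell is
  constant.\<close>

definition merge_code :: com where
  "merge_code = While (ILess 16 12)
     (Cond (ILess 14 10)
        (Cond (ILess 15 11)
           (Do [ILoad 17 14, ILoad 18 15, RLoad 0 17, RLoad 1 18] ;;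
            Cond (RLess 1 0) take_right take_left)
           take_left)
        take_right ;;
      Do [IStore 16 17, IAdd 16 16 3])"

text \<open>Register 13 is the \<open>k\<close> of \<open>merge_pass\<close>: the caller sets it,
  and it falls back to the block length once the end of the first left segment is known.\<close>

definition pass_code :: "nat \<Rightarrow> nat \<Rightarrow> com" where
  "pass_code a b =
     Do [IMove 14 a, IAdd 9 a 0, IMove 16 b] ;;
     While (ILess 14 9)
       (Do [IAdd 10 14 13] ;; Cond (ILess 9 10) (Do [IMove 10 9]) (Do []) ;;
        Do [IAdd 11 10 7] ;; Cond (ILess 9 11) (Do [IMove 11 9]) (Do []) ;;
        Do [IMove 13 7, IMove 15 10, IAdd 12 16 11, ISub 12 12 14] ;;
        merge_code ;;
        Do [IMove 14 11])"

definition check_code :: com where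
  "check_code =
     Do [IConst 8 0, IAdd 9 6 0, IAdd 15 6 3] ;;
     While (ILess 15 9)
       (Do [ISub 14 15 3, ILoad 17 14, ILoad 18 15, RLoad 0 17, RLoad 1 18] ;;
        Cond (RLess 1 0) (Do [IConst 8 1]) (Do []) ;;
        Do [IAdd 15 15 3])"

text \<open>Register 8 starts at 1 to force a first round. Exchanging registers 4 and 5 makes the
  unshifted output the next input; the third array serves only as the candidate result.\<close>

definition sort_code :: com where
  "sort_code =
     Do [IConst 7 1, IConst 8 1] ;;
     While (ILess 2 8)
       (Do [IMove 13 7] ;; pass_code 4 5 ;; Do [IMove 13 2] ;; pass_code 5 6 ;; check_code ;;
        Do [IMove 20 4, IMove 4 5, IMove 5 20, IAdd 7 7 7]) ;;
     Do [IMove 0 6]"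

text \<open>\<open>remdups\<close> keeps last occurrences, so \<Xi> is read backwards and the output
  is filled from its upper end. The \<open>n\<close> cells behind \<Xi> are initially zero and serve
  as marks for the references already seen.\<close>

definition dedup_code :: com where
  "dedup_code =
     Do [IConst 3 1, IAdd 4 1 0, IAdd 5 4 0, IAdd 6 5 0, IMove 14 1, IMove 16 5] ;;
     While (ILess 2 14)
       (Do [ISub 14 14 3, ILoad 17 14, IAdd 20 1 17, ILoad 19 20] ;;
        Cond (ILess 19 3) (Do [IStore 20 3, ISub 16 16 3, IStore 16 17]) (Do []))"

section \<open>Correctness and running time of the program\<close>

lemmas exec_defs = set_ireg_def set_rreg_def

text \<open>The output range is kept apart from both inputs, so unread entries still have their
  initial contents. The last conjunct bounds the credits spent, so that callers can add up
  costs.\<close>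

lemma wp_merge_code:
  fixes s :: config
  defines "i \<equiv> ireg s 14" and "mid \<equiv> ireg s 10" and "j \<equiv> ireg s 15" and "hi \<equiv> ireg s 11"
    and "q \<equiv> ireg s 16" and "qe \<equiv> ireg s 12"
  assumes one: "ireg s 3 = 1" and le: "i \<le> mid" "j \<le> hi"
    and qe: "qe = q + (mid - i) + (hi - j)"
    and disj: "qe \<le> i \<or> mid \<le> q" "qe \<le> j \<or> hi \<le> q"
    and n: "20 * (qe - q) + 2 \<le> n"
  shows "wp merge_code (\<lambda>s' n'. rmem s' = rmem s \<and> (\<forall>r < 14. ireg s' r = ireg s r) \<and>
      ireg s' 16 = qe \<and> (\<forall>k. k < q \<or> qe \<le> k \<longrightarrow> imem s' k = imem s k) \<and>
      seg (imem s') q qe = merge (rmem s) (seg (imem s) i mid) (seg (imem s) j hi) \<and>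
      n \<le> n' + 20 * (qe - q) + 2) s n"
proof -
  let ?L = "\<lambda>a. seg (imem s) a mid" and ?R = "\<lambda>a. seg (imem s) a hi"
  define core where "core s' \<longleftrightarrow> rmem s' = rmem s \<and> (\<forall>r < 14. ireg s' r = ireg s r) \<and>
      i \<le> ireg s' 14 \<and> ireg s' 14 \<le> mid \<and> j \<le> ireg s' 15 \<and> ireg s' 15 \<le> hi \<and> q \<le> ireg s' 16 \<and>
      qe = ireg s' 16 + (mid - ireg s' 14) + (hi - ireg s' 15) \<and>
      (\<forall>k. k < q \<or> qe \<le> k \<longrightarrow> imem s' k = imem s k) \<and>
      seg (imem s') q (ireg s' 16) @ merge (rmem s) (?L (ireg s' 14)) (?R (ireg s' 15)) =
        merge (rmem s) (?L i) (?R j)" for s' :: config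
  define Inv where "Inv s' n' \<longleftrightarrow> core s' \<and> n + 20 * q \<le> n' + 20 * ireg s' 16" for s' :: config and n'
  let ?store = "Do [IStore 16 17, IAdd 16 16 3]"
  have regs: "ireg s' 3 = 1" "ireg s' 10 = mid" "ireg s' 11 = hi" "ireg s' 12 = qe" if "core s'" for s' :: config
    using that one by (auto simp: core_def mid_def hi_def qe_def)
  \<comment> \<open>The 16 is what remains of the 20 credits for one cell after the four steps that
    take and store an entry.\<close>
  have left: "wp take_left (wp ?store Inv) s' n'"
    if c: "core s'" and lt: "ireg s' 14 < mid"
      and take: "ireg s' 15 < hi \<Longrightarrow>
        \<not> rmem s (imem s (ireg s' 15)) < rmem s (imem s (ireg s' 14))"
      and n': "4 \<le> n'" "n + 20 * q \<le> n' + 20 * ireg s' 16 + 16" for s' :: config and n'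
  proof -
    have "imem s' (ireg s' 14) = imem s (ireg s' 14)"
      using c lt disj by (auto simp: core_def)
    moreover have "merge (rmem s) (?L (ireg s' 14)) (?R (ireg s' 15)) =
        imem s (ireg s' 14) # merge (rmem s) (?L (Suc (ireg s' 14))) (?R (ireg s' 15))"
      using lt take seg_Cons[of "ireg s' 15" hi "imem s"]
      by (cases "ireg s' 15 < hi") (auto simp: seg_Cons[of "ireg s' 14"])
    ultimately show ?thesis
      unfolding take_left_def using c lt n' regs[OF c]
      by (intro wp_Do) (auto simp: exec_defs Inv_def core_def seg_snoc)
  qed
  have right: "wp take_right (wp ?store Inv) s' n'"
    if c: "core s'" and lt: "ireg s' 15 < hi"
      and take: "ireg s' 14 < mid \<Longrightarrow>
        rmem s (imem s (ireg s' 15)) < rmem s (imem s (ireg s' 14))"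
      and n': "4 \<le> n'" "n + 20 * q \<le> n' + 20 * ireg s' 16 + 16" for s' :: config and n'
  proof -
    have "imem s' (ireg s' 15) = imem s (ireg s' 15)"
      using c lt disj by (auto simp: core_def)
    moreover have "merge (rmem s) (?L (ireg s' 14)) (?R (ireg s' 15)) =
        imem s (ireg s' 15) # merge (rmem s) (?L (ireg s' 14)) (?R (Suc (ireg s' 15)))"
      using lt take seg_Cons[of "ireg s' 14" mid "imem s"]
      by (cases "ireg s' 14 < mid") (auto simp: seg_Cons[of "ireg s' 15"])
    ultimately show ?thesis
      unfolding take_right_def using c lt n' regs[OF c]
      by (intro wp_Do) (auto simp: exec_defs Inv_def core_def seg_snoc)
  qed
  show ?thesis
    unfolding merge_code_def
  proof (rule wp_While[where Inv = Inv])
    show "Inv s n"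
      using le qe by (auto simp: Inv_def core_def i_def j_def q_def)
  next
    fix s' n' assume inv: "Inv s' n'" and "holds (ILess 16 12) s'"
    then have c: "core s'" and lt: "ireg s' 16 < qe"
      using regs by (auto simp: Inv_def)
    have n': "n + 20 * q \<le> n' + 20 * ireg s' 16" using inv by (simp add: Inv_def)
    have "q \<le> ireg s' 16" using c by (simp add: core_def)
    then have big: "22 \<le> n'" using n n' lt by linarith
    let ?s = "fold exec [ILoad 17 14, ILoad 18 15, RLoad 0 17, RLoad 1 18] s'"
    have c': "core ?s" using c by (auto simp: core_def exec_defs)
    have upd: "ireg ?s 14 = ireg s' 14" "ireg ?s 15 = ireg s' 15" "ireg ?s 16 = ireg s' 16"
      by (auto simp: exec_defs)
    have keys: "rreg ?s 0 = rmem s (imem s (ireg s' 14))" "rreg ?s 1 = rmem s (imem s (ireg s' 15))"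
      if "ireg s' 14 < mid" "ireg s' 15 < hi"
    proof -
      have "imem s' (ireg s' 14) = imem s (ireg s' 14)" "imem s' (ireg s' 15) = imem s (ireg s' 15)"
        using c that disj by (auto simp: core_def)
      then show "rreg ?s 0 = rmem s (imem s (ireg s' 14))" "rreg ?s 1 = rmem s (imem s (ireg s' 15))"
        using c by (auto simp: exec_defs core_def)
    qed
    have "\<not> ireg s' 14 < mid \<Longrightarrow> ireg s' 15 < hi" using c lt by (auto simp: core_def)
    then show "2 \<le> n' \<and> wp (Cond (ILess 14 10)
        (Cond (ILess 15 11)
           (Do [ILoad 17 14, ILoad 18 15, RLoad 0 17, RLoad 1 18] ;;
            Cond (RLess 1 0) take_right take_left)
           take_left)
        take_right ;; ?store) Inv s' (n' - 2)"
      using big n' regs[OF c] upd keys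
      by (intro conjI wp_Seq wp_Cond wp_Do left right c c') (auto simp del: fold.simps)
  next
    fix s' n' assume inv: "Inv s' n'" and ex: "\<not> holds (ILess 16 12) s'"
    then have c: "core s'" by (simp add: Inv_def)
    then have q': "ireg s' 16 = qe" "ireg s' 14 = mid" "ireg s' 15 = hi"
      using ex regs[OF c] by (auto simp: core_def)
    have "n + 20 * q \<le> n' + 20 * qe" using inv q' by (simp add: Inv_def)
    moreover have "q \<le> qe" using qe by simp
    ultimately have "2 \<le> n'" "n \<le> n' - 2 + 20 * (qe - q) + 2" using n by auto
    then show "2 \<le> n' \<and> rmem s' = rmem s \<and> (\<forall>r < 14. ireg s' r = ireg s r) \<and>
      ireg s' 16 = qe \<and> (\<forall>k. k < q \<or> qe \<le> k \<longrightarrow> imem s' k = imem s k) \<and>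
      seg (imem s') q qe = merge (rmem s) (?L i) (?R j) \<and> n \<le> n' - 2 + 20 * (qe - q) + 2"
      using c q' by (auto simp: core_def)
  qed
qed

text \<open>Since \<open>0 < w\<close>, every merge emits at least one entry. So 20 credits per
  entry pay for merging and another 20 for the fixed cost around each merge.\<close>

lemma wp_pass_code:
  fixes s :: config and a b :: nat
  defines "len \<equiv> ireg s 0" and "src \<equiv> ireg s a" and "dst \<equiv> ireg s b" and "w \<equiv> ireg s 7"
  assumes ab: "a < 9" "b < 9" and one: "ireg s 3 = 1" and w: "0 < w"
    and disj: "src + len \<le> dst \<or> dst + len \<le> src"
    and n: "40 * len + 5 \<le> n"
  shows "wp (pass_code a b) (\<lambda>s' n'. rmem s' = rmem s \<and> (\<forall>r < 9. ireg s' r = ireg s r) \<and>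
      (\<forall>k. k < dst \<or> dst + len \<le> k \<longrightarrow> imem s' k = imem s k) \<and>
      seg (imem s') dst (dst + len) =
        merge_pass (rmem s) (ireg s 13) w (seg (imem s) src (src + len)) \<and>
      n \<le> n' + 40 * len + 5) s n"
proof -
  let ?X = "\<lambda>i. seg (imem s) i (src + len)"
  define core where "core s' \<longleftrightarrow> rmem s' = rmem s \<and> (\<forall>r < 9. ireg s' r = ireg s r) \<and>
      ireg s' 9 = src + len \<and> src \<le> ireg s' 14 \<and> ireg s' 14 \<le> src + len \<and>
      ireg s' 16 + src = dst + ireg s' 14 \<and>
      (\<forall>k. k < dst \<or> dst + len \<le> k \<longrightarrow> imem s' k = imem s k) \<and>
      seg (imem s') dst (ireg s' 16) @ merge_pass (rmem s) (ireg s' 13) w (?X (ireg s' 14)) =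
        merge_pass (rmem s) (ireg s 13) w (?X src)" for s' :: config
  define Inv where "Inv s' n' \<longleftrightarrow> core s' \<and> n + 40 * src \<le> n' + 40 * ireg s' 14 + 3" for s' :: config and n'
  let ?s0 = "fold exec [IMove 14 a, IAdd 9 a 0, IMove 16 b] s"
  have init: "core ?s0"
    using ab by (auto simp: exec_defs core_def src_def dst_def len_def)
  have init14: "ireg ?s0 14 = src" using ab by (auto simp: exec_defs src_def)
  show ?thesis
    unfolding pass_code_def
  proof (intro wp_Seq wp_Do wp_While[where Inv = Inv])
    show "Inv ?s0 (n - length [IMove 14 a, IAdd 9 a 0, IMove 16 b])"
      using init init14 n by (simp add: Inv_def del: fold.simps)
  next
    fix s' n' assume inv: "Inv s' n'" and h: "holds (ILess 14 9) s'"
    then have c: "core s'" by (simp add: Inv_def)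
    define i where "i = ireg s' 14"
    define mid where "mid = min (i + ireg s' 13) (src + len)"
    define hi where "hi = min (mid + w) (src + len)"
    have i: "src \<le> i" "i < src + len" using c h by (auto simp: core_def i_def)
    have hi: "i < hi" "i \<le> mid" "mid \<le> hi" "hi \<le> src + len"
      using i w by (auto simp: hi_def mid_def)
    have n': "n + 40 * src \<le> n' + 40 * i + 3" using inv by (simp add: Inv_def i_def)
    have big: "20 * (hi - i) + 22 \<le> n'" using n' n i hi by linarith
    have c7: "ireg s' 7 = w" "ireg s' 3 = 1" using c one by (auto simp: core_def w_def)
    have q: "ireg s' 16 + src = dst + i" using c by (simp add: core_def i_def)
    \<comment> \<open>All outcomes of the two clipping tests lead to these registers; only the
      program counter may differ. Loop test and preparation take 12 steps.\<close>
    define s1 where "s1 = s'\<lparr>ireg := (ireg s')(10 := mid, 11 := hi, 13 := w, 15 := mid,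
        12 := ireg s' 16 + hi - i)\<rparr>"
    have merge: "wp merge_code (wp (Do [IMove 14 11]) Inv) s2 n2"
      if s2: "ireg s2 = ireg s1" "imem s2 = imem s1" "rmem s2 = rmem s1"
        and n2: "n' \<le> n2 + 12" for s2 n2
    proof (rule wp_mono[OF wp_merge_code])
      show "ireg s2 3 = 1" using s2 c7 by (simp add: s1_def)
      show "ireg s2 14 \<le> ireg s2 10" "ireg s2 15 \<le> ireg s2 11"
        using s2 hi by (auto simp: s1_def i_def)
      show "ireg s2 12 = ireg s2 16 + (ireg s2 10 - ireg s2 14) + (ireg s2 11 - ireg s2 15)"
        using s2 hi by (auto simp: s1_def i_def)
      show "ireg s2 12 \<le> ireg s2 14 \<or> ireg s2 10 \<le> ireg s2 16"
        "ireg s2 12 \<le> ireg s2 15 \<or> ireg s2 11 \<le> ireg s2 16"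
        using s2 hi q disj i by (auto simp: s1_def i_def)
      show "20 * (ireg s2 12 - ireg s2 16) + 2 \<le> n2"
        using s2 hi big n2 by (auto simp: s1_def i_def)
    next
      fix s3 :: config and n3
      assume A: "rmem s3 = rmem s2 \<and> (\<forall>r < 14. ireg s3 r = ireg s2 r) \<and>
        ireg s3 16 = ireg s2 12 \<and>
        (\<forall>k. k < ireg s2 16 \<or> ireg s2 12 \<le> k \<longrightarrow> imem s3 k = imem s2 k) \<and>
        seg (imem s3) (ireg s2 16) (ireg s2 12) = merge (rmem s2)
          (seg (imem s2) (ireg s2 14) (ireg s2 10)) (seg (imem s2) (ireg s2 15) (ireg s2 11)) \<and>
        n2 \<le> n3 + 20 * (ireg s2 12 - ireg s2 16) + 2"
      have regs: "ireg s3 11 = hi" "ireg s3 13 = w" "ireg s3 9 = src + len"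
          "ireg s3 16 = ireg s' 16 + hi - i" "\<forall>r < 9. ireg s3 r = ireg s r"
        using A s2 c by (auto simp: s1_def core_def)
      have rm: "rmem s3 = rmem s" using A s2 c by (auto simp: s1_def core_def)
      have mem3: "imem s3 k = imem s' k" if "k < ireg s' 16 \<or> ireg s' 16 + hi - i \<le> k" for k
        using A s2 that by (auto simp: s1_def)
      have mem: "imem s3 k = imem s k" if "k < dst \<or> dst + len \<le> k" for k
      proof -
        have "k < ireg s' 16 \<or> ireg s' 16 + hi - i \<le> k" using that q i hi by linarith
        then show ?thesis using mem3 c that by (auto simp: core_def)
      qed
      have src_eq: "seg (imem s') x y = seg (imem s) x y" if "src \<le> x" "y \<le> src + len" for x y
        using c that disj by (intro seg_cong) (auto simp: core_def)
      have "seg (imem s3) (ireg s' 16) (ireg s' 16 + hi - i) =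
          merge (rmem s) (seg (imem s) i mid) (seg (imem s) mid hi)"
        using A s2 c src_eq[of i mid] src_eq[of mid hi] i hi
        by (auto simp: s1_def core_def i_def)
      moreover have "seg (imem s3) dst (ireg s' 16) = seg (imem s') dst (ireg s' 16)"
        using mem3 by (intro seg_cong) auto
      moreover have "seg (imem s3) dst (ireg s' 16 + hi - i) =
          seg (imem s3) dst (ireg s' 16) @ seg (imem s3) (ireg s' 16) (ireg s' 16 + hi - i)"
        using q i hi by (intro seg_append[symmetric]) auto
      moreover have "merge_pass (rmem s) (ireg s' 13) w (?X i) =
          merge (rmem s) (seg (imem s) i mid) (seg (imem s) mid hi) @
          merge_pass (rmem s) w w (?X hi)"
        using i w by (intro merge_pass_seg) (auto simp: mid_def hi_def)
      ultimately have result: "seg (imem s3) dst (ireg s3 16) @ merge_pass (rmem s) w w (?X hi) =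
          merge_pass (rmem s) (ireg s 13) w (?X src)"
        using c regs by (simp add: core_def i_def)
      have "n2 \<le> n3 + 20 * (hi - i) + 2" using A s2 hi by (auto simp: s1_def i_def)
      then have "1 \<le> n3" "n + 40 * src \<le> n3 - 1 + 40 * hi + 3"
        using n2 n' hi big by linarith+
      then show "wp (Do [IMove 14 11]) Inv s3 n3"
        using regs rm mem result i hi q
        by (intro wp_Do) (auto simp: exec_defs Inv_def core_def)
    qed
    show "2 \<le> n' \<and> wp (Do [IAdd 10 14 13] ;; Cond (ILess 9 10) (Do [IMove 10 9]) (Do []) ;;
        Do [IAdd 11 10 7] ;; Cond (ILess 9 11) (Do [IMove 11 9]) (Do []) ;;
        Do [IMove 13 7, IMove 15 10, IAdd 12 16 11, ISub 12 12 14] ;;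
        merge_code ;; Do [IMove 14 11]) Inv s' (n' - 2)"
      using big c c7
      by (intro conjI wp_Seq wp_Cond wp_Do merge)
        (auto simp: exec_defs core_def s1_def i_def mid_def hi_def min_def fun_eq_iff)
  next
    fix s' n' assume inv: "Inv s' n'" and h: "\<not> holds (ILess 14 9) s'"
    then have c: "core s'" by (simp add: Inv_def)
    then have fin: "ireg s' 14 = src + len" "ireg s' 16 = dst + len"
      using h by (auto simp: core_def)
    then have "n \<le> n' + 40 * len + 3" using inv by (simp add: Inv_def)
    then have "2 \<le> n'" "n \<le> n' - 2 + 40 * len + 5" using n by linarith+
    then show "2 \<le> n' \<and> rmem s' = rmem s \<and> (\<forall>r < 9. ireg s' r = ireg s r) \<and>
      (\<forall>k. k < dst \<or> dst + len \<le> k \<longrightarrow> imem s' k = imem s k) \<and>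
      seg (imem s') dst (dst + len) = merge_pass (rmem s) (ireg s 13) w (?X src) \<and>
      n \<le> n' - 2 + 40 * len + 5"
      using c fin by (auto simp: core_def)
  qed (use n in auto)
qed


lemma sorted_snoc2: "sorted (xs @ [x, y]) \<longleftrightarrow> sorted (xs @ [x]) \<and> x \<le> (y :: real)"
  by (auto simp: sorted_append)

lemma wp_check_code:
  fixes s :: config
  defines "len \<equiv> ireg s 0" and "c \<equiv> ireg s 6"
  assumes one: "ireg s 3 = 1" and n: "20 * len + 5 \<le> n"
  shows "wp check_code (\<lambda>s' n'. rmem s' = rmem s \<and> imem s' = imem s \<and>
      (\<forall>r < 8. ireg s' r = ireg s r) \<and>
      ireg s' 8 = (if sorted (map (rmem s) (seg (imem s) c (c + len))) then 0 else 1) \<and>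
      n \<le> n' + 20 * len + 5) s n"
proof -
  let ?bad = "\<lambda>j. if sorted (map (rmem s) (seg (imem s) c j)) then 0 else (1 :: nat)"
  \<comment> \<open>Register 15 is the upper position of the next pair to compare. It starts one
    past the beginning, which is already beyond the end if the array is empty.\<close>
  define core where "core s' \<longleftrightarrow> rmem s' = rmem s \<and> imem s' = imem s \<and>
      (\<forall>r < 8. ireg s' r = ireg s r) \<and> ireg s' 9 = c + len \<and>
      c < ireg s' 15 \<and> (ireg s' 15 \<le> c + len \<or> len = 0 \<and> ireg s' 15 = Suc c) \<and>
      ireg s' 8 = ?bad (ireg s' 15)" for s' :: config
  define Inv where "Inv s' n' \<longleftrightarrow> core s' \<and> n + 20 * c + 20 \<le> n' + 20 * ireg s' 15 + 3"
    for s' :: config and n'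
  let ?is = "[IConst 8 0, IAdd 9 6 0, IAdd 15 6 3]"
  have init: "core (fold exec ?is s)" "ireg (fold exec ?is s) 15 = Suc c"
    using one by (auto simp: exec_defs core_def c_def len_def seg_snoc)
  show ?thesis
    unfolding check_code_def
  proof (intro wp_Seq wp_Do wp_While[where Inv = Inv])
    show "Inv (fold exec ?is s) (n - length ?is)"
      using init n by (simp add: Inv_def del: fold.simps)
  next
    fix s' n' assume inv: "Inv s' n'" and h: "holds (ILess 15 9) s'"
    then have core: "core s'" by (simp add: Inv_def)
    define j where "j = ireg s' 15"
    have j: "c < j" "j < c + len" using core h by (auto simp: core_def j_def)
    have n': "n + 20 * c + 20 \<le> n' + 20 * j + 3" using inv by (simp add: Inv_def j_def)
    have big: "20 \<le> n'" using n' n j by simp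
    have "seg (imem s) c (Suc j) = seg (imem s) c (j - 1) @ [imem s (j - 1), imem s j]"
      "seg (imem s) c j = seg (imem s) c (j - 1) @ [imem s (j - 1)]"
      using j seg_snoc[of c "j - 1" "imem s"] seg_snoc[of c j "imem s"] by auto
    then have bad: "?bad (Suc j) =
        (if rmem s (imem s j) < rmem s (imem s (j - 1)) then 1 else ?bad j)"
      using sorted_snoc2[of "map (rmem s) (seg (imem s) c (j - 1))"] by auto
    have "ireg s' 3 = 1" using core one by (simp add: core_def)
    then show "2 \<le> n' \<and> wp (Do [ISub 14 15 3, ILoad 17 14, ILoad 18 15, RLoad 0 17, RLoad 1 18] ;;
        Cond (RLess 1 0) (Do [IConst 8 1]) (Do []) ;; Do [IAdd 15 15 3]) Inv s' (n' - 2)"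
      using big n' core bad j
      by (intro conjI wp_Seq wp_Cond wp_Do)
        (auto simp: exec_defs Inv_def core_def j_def[symmetric] simp del: seg_eq_Nil_iff)
  next
    fix s' n' assume inv: "Inv s' n'" and h: "\<not> holds (ILess 15 9) s'"
    then have core: "core s'" by (simp add: Inv_def)
    then consider "ireg s' 15 = c + len" "0 < len" | "len = 0" "ireg s' 15 = Suc c"
      using h by (auto simp: core_def)
    then have "?bad (ireg s' 15) = ?bad (c + len) \<and> ireg s' 15 \<le> c + len + 1"
    proof cases
      case 2
      then show ?thesis using seg_snoc[of c c "imem s"] by simp
    qed simp
    moreover from this have "2 \<le> n'" "n \<le> n' - 2 + 20 * len + 5"
      using inv n unfolding Inv_def by linarith+
    ultimately show "2 \<le> n' \<and> rmem s' = rmem s \<and> imem s' = imem s \<and>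
      (\<forall>r < 8. ireg s' r = ireg s r) \<and> ireg s' 8 = ?bad (c + len) \<and>
      n \<le> n' - 2 + 20 * len + 5"
      using core by (simp add: core_def)
  qed (use n in auto)
qed

text \<open>The exponent \<open>e\<close> occurs only in the analysis. Round \<open>k\<close> starts
  with blocks of length \<open>2 ^ k\<close> and round \<open>e\<close> must succeed, so there are
  at most \<open>e + 1\<close> rounds; each costs two passes at 40 and a check at 20 per entry, plus
  a constant.\<close>

lemma wp_sort_code:
  fixes s :: config
  defines "len \<equiv> ireg s 0" and "base \<equiv> ireg s 4"
  defines "ys \<equiv> seg (imem s) base (base + len)"
  assumes regs: "ireg s 2 = 0" "ireg s 3 = 1" "ireg s 5 = base + len" "ireg s 6 = base + 2 * len"
    and loc: "local_order (2 ^ e) (map (rmem s) ys)"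
    and n: "(e + 1) * (100 * len + 40) + 5 \<le> n"
  shows "wp sort_code (\<lambda>s' n'. rmem s' = rmem s \<and>
      mset (seg (imem s') (ireg s' 0) (ireg s' 0 + len)) = mset ys \<and>
      sorted (map (rmem s) (seg (imem s') (ireg s' 0) (ireg s' 0 + len)))) s n"
proof -
  let ?f = "rmem s" and ?C = "base + 2 * len" and ?cost = "100 * len + 40"
  let ?swap = "[IMove 20 4, IMove 4 5, IMove 5 20, IAdd 7 7 7]"
  define frame where "frame s' \<longleftrightarrow> rmem s' = ?f \<and> ireg s' 0 = len \<and> ireg s' 2 = 0 \<and>
      ireg s' 3 = 1 \<and> ireg s' 6 = ?C \<and>
      (ireg s' 4 = base \<and> ireg s' 5 = base + len \<or> ireg s' 4 = base + len \<and> ireg s' 5 = base)"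
    for s' :: config
  define active where "active k s' \<longleftrightarrow> frame s' \<and> k \<le> e \<and> ireg s' 7 = 2 ^ k \<and>
      (let xs = seg (imem s') (ireg s' 4) (ireg s' 4 + len) in
        mset xs = mset ys \<and> sorted_blocks (2 ^ k) (map ?f xs) \<and> local_order (2 ^ e) (map ?f xs))"
    for k and s' :: config
  define final where "final s' \<longleftrightarrow> frame s' \<and>
      (let zs = seg (imem s') ?C (?C + len) in mset zs = mset ys \<and> sorted (map ?f zs))"
    for s' :: config
  define Inv where "Inv s' n' \<longleftrightarrow>
      ireg s' 8 = 1 \<and> (\<exists>k. active k s' \<and> (e - k + 1) * ?cost + 3 \<le> n') \<or>
      ireg s' 8 = 0 \<and> final s' \<and> 3 \<le> n'" for s' :: config and n'
  show ?thesis
    unfolding sort_code_def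
  proof (intro wp_Seq wp_Do[of "[IConst 7 1, IConst 8 1]"] wp_While[where Inv = Inv])
    have "active 0 (fold exec [IConst 7 1, IConst 8 1] s)"
      using regs loc sorted_blocks_1[of "map ?f ys"]
      by (auto simp: exec_defs active_def frame_def len_def base_def ys_def)
    moreover have "ireg (fold exec [IConst 7 1, IConst 8 1] s) 8 = 1" by (simp add: exec_defs)
    moreover have "(e - 0 + 1) * ?cost + 3 \<le> n - length [IConst 7 1, IConst 8 1]"
      using n by simp
    ultimately show "Inv (fold exec [IConst 7 1, IConst 8 1] s) (n - length [IConst 7 1, IConst 8 1])"
      unfolding Inv_def by blast
  next
    fix s0 n0 assume inv: "Inv s0 n0" and h: "holds (ILess 2 8) s0"
    have "ireg s0 2 = 0" using inv by (auto simp: Inv_def active_def final_def frame_def)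
    then obtain k where act: "active k s0" and n0: "(e - k + 1) * ?cost + 3 \<le> n0"
      using inv h by (auto simp: Inv_def)
    have fr: "frame s0" using act by (simp add: active_def)
    have big: "?cost + 3 \<le> n0"
      using n0 by (simp add: algebra_simps)
    define w a b where "w = (2 :: nat) ^ k" and "a = ireg s0 4" and "b = ireg s0 5"
    define xs where "xs = seg (imem s0) a (a + len)"
    have xs: "mset xs = mset ys" "sorted_blocks w (map ?f xs)" "local_order (2 ^ e) (map ?f xs)"
      using act by (auto simp: active_def xs_def a_def w_def Let_def)
    have w: "0 < w" "ireg s0 7 = w" using act by (auto simp: active_def w_def)
    have ab: "a + len \<le> b \<or> b + len \<le> a" "b + len \<le> ?C"
      using fr by (auto simp: frame_def a_def b_def)
    define bs cs where "bs = merge_pass ?f w w xs" and "cs = merge_pass ?f 0 w bs"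
    have bs: "sorted_blocks (2 * w) (map ?f bs)" "local_order (2 ^ e) (map ?f bs)"
      using sorted_blocks_merge_pass[OF xs(2) w(1)]
        local_order_merge_pass[OF xs(2) w(1), of "2 ^ e" "[]"] xs(3)
      by (auto simp: bs_def map_merge_pass)
    \<comment> \<open>Here the block length \<open>w\<close> equals the locality bound
      \<open>2 ^ e\<close>, as \<open>sorted_merge_pass\<close> demands.\<close>
    have cs: "sorted (map ?f cs)" if "k = e"
      using sorted_merge_pass[of 0 "map ?f bs" w] bs w(1) that
      by (simp add: cs_def map_merge_pass w_def)
    have last: "Inv (fold exec ?swap s3) (n3 - length ?swap)"
      if s3: "rmem s3 = ?f" "\<forall>r < 8. ireg s3 r = ireg s0 r"
          "ireg s3 8 = (if sorted (map ?f cs) then 0 else 1)"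
          "seg (imem s3) b (b + len) = bs" "seg (imem s3) ?C (?C + len) = cs"
        and n3: "n0 \<le> n3 + ?cost - 4" "7 \<le> n3" for s3 :: config and n3
    proof -
      let ?s = "fold exec ?swap s3"
      have fr': "frame ?s" using fr s3 by (auto simp: exec_defs frame_def)
      show ?thesis
      proof (cases "sorted (map ?f cs)")
        case True
        then have "final ?s"
          using fr' s3 xs by (auto simp: exec_defs final_def cs_def bs_def)
        then show ?thesis using s3 True n3 by (auto simp: exec_defs Inv_def)
      next
        case False
        then have "k \<noteq> e" using cs by blast
        then have k: "Suc k \<le> e" using act by (auto simp: active_def)
        then have "active (Suc k) ?s"
          using fr' s3 xs bs w
          by (auto simp: exec_defs active_def b_def bs_def w_def)
        moreover have "e - k = Suc (e - Suc k)" using k by simp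
        then have "(e - Suc k + 1) * ?cost + 3 \<le> n3 - 4"
          using n0 n3 by simp
        ultimately show ?thesis using s3 False by (auto simp: exec_defs Inv_def)
      qed
    qed
    have pass1: "wp (pass_code 4 5) (\<lambda>s1 n1. rmem s1 = ?f \<and> (\<forall>r < 9. ireg s1 r = ireg s0 r) \<and>
        seg (imem s1) b (b + len) = bs \<and> n0 \<le> n1 + 40 * len + 8) s' n'"
      if "s' = fold exec [IMove 13 7] s0" "n' = n0 - 2 - 1" for s' n'
    proof (rule wp_mono[OF wp_pass_code])
      show "40 * ireg s' 0 + 5 \<le> n'" using that fr big by (simp add: exec_defs frame_def)
    qed (use that fr w ab big in \<open>auto simp: exec_defs frame_def a_def b_def bs_def xs_def\<close>)
    have pass2: "wp (pass_code 5 6) (\<lambda>s2 n2. rmem s2 = ?f \<and> (\<forall>r < 9. ireg s2 r = ireg s0 r) \<and>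
        seg (imem s2) b (b + len) = bs \<and> seg (imem s2) ?C (?C + len) = cs \<and>
        n0 \<le> n2 + 80 * len + 14) (fold exec [IMove 13 2] s1) (n1 - 1)"
      if s1: "rmem s1 = ?f" "\<forall>r < 9. ireg s1 r = ireg s0 r" "seg (imem s1) b (b + len) = bs"
        "n0 \<le> n1 + 40 * len + 8" for s1 n1
    proof (rule wp_mono[OF wp_pass_code])
      let ?s = "fold exec [IMove 13 2] s1"
      show "40 * ireg ?s 0 + 5 \<le> n1 - 1" using s1 fr big by (simp add: exec_defs frame_def)
      fix s2 :: config and n2
      assume A: "rmem s2 = rmem ?s \<and> (\<forall>r < 9. ireg s2 r = ireg ?s r) \<and>
        (\<forall>k. k < ireg ?s 6 \<or> ireg ?s 6 + ireg ?s 0 \<le> k \<longrightarrow> imem s2 k = imem ?s k) \<and>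
        seg (imem s2) (ireg ?s 6) (ireg ?s 6 + ireg ?s 0) = merge_pass (rmem ?s) (ireg ?s 13)
          (ireg ?s 7) (seg (imem ?s) (ireg ?s 5) (ireg ?s 5 + ireg ?s 0)) \<and>
        n1 - 1 \<le> n2 + 40 * ireg ?s 0 + 5"
      have "seg (imem s2) b (b + len) = seg (imem s1) b (b + len)"
        using A s1 fr ab(2) by (intro seg_cong) (auto simp: exec_defs frame_def)
      then show "rmem s2 = ?f \<and> (\<forall>r < 9. ireg s2 r = ireg s0 r) \<and>
        seg (imem s2) b (b + len) = bs \<and> seg (imem s2) ?C (?C + len) = cs \<and>
        n0 \<le> n2 + 80 * len + 14"
        using A s1 fr w by (auto simp: exec_defs frame_def cs_def b_def)
    qed (use s1 fr w ab in \<open>auto simp: exec_defs frame_def b_def\<close>)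
    have check: "wp check_code (wp (Do ?swap) Inv) s2 n2"
      if s2: "rmem s2 = ?f" "\<forall>r < 9. ireg s2 r = ireg s0 r" "seg (imem s2) b (b + len) = bs"
        "seg (imem s2) ?C (?C + len) = cs" "n0 \<le> n2 + 80 * len + 14" for s2 n2
    proof (rule wp_mono[OF wp_check_code])
      show "20 * ireg s2 0 + 5 \<le> n2" using s2 fr big by (simp add: frame_def)
      fix s3 :: config and n3
      assume "rmem s3 = rmem s2 \<and> imem s3 = imem s2 \<and> (\<forall>r < 8. ireg s3 r = ireg s2 r) \<and>
        ireg s3 8 = (if sorted (map (rmem s2) (seg (imem s2) (ireg s2 6) (ireg s2 6 + ireg s2 0)))
          then 0 else 1) \<and> n2 \<le> n3 + 20 * ireg s2 0 + 5"
      moreover from this have "n0 \<le> n3 + ?cost - 4" "7 \<le> n3"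
        using s2 fr big by (auto simp: frame_def)
      ultimately show "wp (Do ?swap) Inv s3 n3"
        using last[of s3 n3] s2 fr by (intro wp_Do) (auto simp: frame_def simp del: fold.simps)
    qed (use s2 fr in \<open>auto simp: frame_def\<close>)
    have "wp (Do [IMove 13 7] ;; pass_code 4 5 ;; Do [IMove 13 2] ;; pass_code 5 6 ;; check_code ;;
        Do ?swap) Inv s0 (n0 - 2)"
    proof (intro wp_Seq wp_Do[of "[IMove 13 7]"])
      show "wp (pass_code 4 5) (wp (Do [IMove 13 2] ;; pass_code 5 6 ;; check_code ;; Do ?swap) Inv)
          (fold exec [IMove 13 7] s0) (n0 - 2 - length [IMove 13 7])"
      proof (rule wp_mono[OF pass1])
        fix s1 :: config and n1
        assume s1: "rmem s1 = ?f \<and> (\<forall>r < 9. ireg s1 r = ireg s0 r) \<and>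
          seg (imem s1) b (b + len) = bs \<and> n0 \<le> n1 + 40 * len + 8"
        have "wp (pass_code 5 6) (wp (check_code ;; Do ?swap) Inv)
            (fold exec [IMove 13 2] s1) (n1 - 1)"
          by (rule wp_mono[OF pass2]) (use s1 check in \<open>blast intro: wp_Seq\<close>)+
        then show "wp (Do [IMove 13 2] ;; pass_code 5 6 ;; check_code ;; Do ?swap) Inv s1 n1"
          using s1 big by (intro wp_Seq wp_Do) auto
      qed auto
    qed (use big in auto)
    then show "2 \<le> n0 \<and> wp (Do [IMove 13 7] ;; pass_code 4 5 ;; Do [IMove 13 2] ;;
        pass_code 5 6 ;; check_code ;;
        Do ?swap) Inv s0 (n0 - 2)"
      using big by simp
  next
    fix s' n' assume inv: "Inv s' n'" and h: "\<not> holds (ILess 2 8) s'"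
    then have "final s'" "3 \<le> n'" by (auto simp: Inv_def active_def frame_def)
    then show "2 \<le> n' \<and> wp (Do [IMove 0 6]) (\<lambda>s' n'. rmem s' = rmem s \<and>
      mset (seg (imem s') (ireg s' 0) (ireg s' 0 + len)) = mset ys \<and>
      sorted (map (rmem s) (seg (imem s') (ireg s' 0) (ireg s' 0 + len)))) s' (n' - 2)"
      by (intro conjI wp_Do) (auto simp: exec_defs final_def frame_def Let_def)
  qed (use n in auto)
qed

lemma wp_dedup_code:
  fixes s :: config
  defines "len \<equiv> ireg s 0" and "m \<equiv> ireg s 1"
  assumes regs: "ireg s 2 = 0" and \<Xi>: "length \<Xi> = m" "set \<Xi> \<subseteq> {..<len}"
    and mem: "\<And>k. k < m \<Longrightarrow> imem s k = \<Xi> ! k" "\<And>k. m \<le> k \<Longrightarrow> imem s k = 0"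
    and n: "12 * m + 8 \<le> n"
  shows "wp dedup_code (\<lambda>s' n'. rmem s' = rmem s \<and> ireg s' 0 = len \<and> ireg s' 2 = 0 \<and>
      ireg s' 3 = 1 \<and> ireg s' 4 = m + len \<and> ireg s' 5 = m + 2 * len \<and> ireg s' 6 = m + 3 * len \<and>
      seg (imem s') (m + 2 * len - card (set \<Xi>)) (m + 2 * len) = remdups \<Xi> \<and>
      n \<le> n' + 12 * m + 8) s n"
proof -
  define core where "core s' \<longleftrightarrow> rmem s' = rmem s \<and> ireg s' 0 = len \<and> ireg s' 1 = m \<and>
      ireg s' 2 = 0 \<and> ireg s' 3 = 1 \<and> ireg s' 4 = m + len \<and> ireg s' 5 = m + 2 * len \<and>
      ireg s' 6 = m + 3 * len \<and> ireg s' 14 \<le> m \<and>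
      (\<forall>k < m. imem s' k = \<Xi> ! k) \<and>
      (\<forall>x < len. imem s' (m + x) = (if x \<in> set (drop (ireg s' 14) \<Xi>) then 1 else 0)) \<and>
      ireg s' 16 + card (set (drop (ireg s' 14) \<Xi>)) = m + 2 * len \<and>
      seg (imem s') (ireg s' 16) (m + 2 * len) = remdups (drop (ireg s' 14) \<Xi>)" for s' :: config
  define Inv where "Inv s' n' \<longleftrightarrow> core s' \<and> n + 12 * ireg s' 14 \<le> n' + 12 * m + 6"
    for s' :: config and n'
  let ?is = "[IConst 3 1, IAdd 4 1 0, IAdd 5 4 0, IAdd 6 5 0, IMove 14 1, IMove 16 5]"
  show ?thesis
    unfolding dedup_code_def
  proof (intro wp_Seq wp_Do[of ?is] wp_While[where Inv = Inv])
    have "core (fold exec ?is s)" "ireg (fold exec ?is s) 14 = m"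
      using regs \<Xi> mem by (auto simp: exec_defs core_def len_def m_def)
    then show "Inv (fold exec ?is s) (n - length ?is)"
      using n by (simp add: Inv_def del: fold.simps)
  next
    fix s' n' assume inv: "Inv s' n'" and h: "holds (ILess 2 14) s'"
    then have core: "core s'" by (simp add: Inv_def)
    define i x where "i = ireg s' 14 - 1" and "x = \<Xi> ! i"
    have i: "ireg s' 14 = Suc i" "i < m" using core h by (auto simp: core_def i_def)
    have x: "x < len" using i \<Xi> nth_mem[of i \<Xi>] unfolding x_def by blast
    have drop: "drop i \<Xi> = x # drop (Suc i) \<Xi>"
      using i \<Xi>(1) by (simp add: x_def Cons_nth_drop_Suc)
    \<comment> \<open>At most \<open>len\<close> references are kept, so the descending output never
      reaches the marks below \<open>m + len\<close>.\<close>
    have card_le: "card (set (drop i \<Xi>)) \<le> len"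
      using \<Xi>(2) set_drop_subset[of i \<Xi>] card_mono[of "{..<len}" "set (drop i \<Xi>)"] by auto
    have n': "n + 12 * i + 12 \<le> n' + 12 * m + 6" using inv i by (simp add: Inv_def)
    have big: "14 \<le> n'" using n' n by simp
    let ?load = "[ISub 14 14 3, ILoad 17 14, IAdd 20 1 17, ILoad 19 20]"
    define t where "t = fold exec ?load s'"
    have t: "ireg t 14 = i" "ireg t 17 = x" "ireg t 20 = m + x"
      "ireg t 19 = (if x \<in> set (drop (Suc i) \<Xi>) then 1 else 0)"
      "\<forall>r < 14. ireg t r = ireg s' r" "ireg t 16 = ireg s' 16" "imem t = imem s'" "rmem t = rmem s'"
      using core i x by (auto simp: t_def exec_defs core_def x_def)
    have "wp (Cond (ILess 19 3) (Do [IStore 20 3, ISub 16 16 3, IStore 16 17]) (Do [])) Inv t (n' - 6)"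
    proof (cases "x \<in> set (drop (Suc i) \<Xi>)")
      case True
      then have "set (drop i \<Xi>) = set (drop (Suc i) \<Xi>)"
        "remdups (drop i \<Xi>) = remdups (drop (Suc i) \<Xi>)"
        unfolding drop by auto
      then have "core t"
        using t core i by (simp add: core_def)
      moreover have "\<not> holds (ILess 19 3) t" using True t core by (simp add: core_def)
      ultimately show ?thesis
        using t(1) big n' by (intro wp_Cond wp_Do) (auto simp: Inv_def)
    next
      case False
      define q where "q = ireg s' 16 - 1"
      have card: "card (set (drop i \<Xi>)) = Suc (card (set (drop (Suc i) \<Xi>)))"
        using False by (simp add: drop)
      have q16: "ireg s' 16 + card (set (drop (Suc i) \<Xi>)) = m + 2 * len"
        using core i by (simp add: core_def)
      have q: "ireg s' 16 = Suc q" "m + len \<le> q" "q < m + 2 * len"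
        using q16 card card_le unfolding q_def by linarith+
      let ?store = "[IStore 20 3, ISub 16 16 3, IStore 16 17]"
      define u where "u = fold exec ?store t"
      have u: "imem u = (imem s')(m + x := 1, q := x)" "ireg u = (ireg t)(16 := q)"
          "rmem u = rmem s'"
      proof -
        have "ireg t 3 = 1" using t(5) core by (simp add: core_def)
        then show "imem u = (imem s')(m + x := 1, q := x)" "ireg u = (ireg t)(16 := q)"
            "rmem u = rmem s'"
          using t(2,3,6,7,8) q(1) by (simp_all add: u_def exec_defs)
      qed
      have "seg (imem u) q (m + 2 * len) = remdups (drop i \<Xi>)"
        using q x core i False by (simp add: u seg_Cons drop core_def)
      moreover have "imem u (m + y) = (if y \<in> set (drop i \<Xi>) then 1 else 0)" if "y < len" for y
        using that core i q by (auto simp: u drop core_def)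
      moreover have "imem u k = \<Xi> ! k" if "k < m" for k
        using that core q by (simp add: u core_def)
      moreover have "q + card (set (drop i \<Xi>)) = m + 2 * len"
        using q16 card q by simp
      ultimately have "core u"
        using t core i unfolding core_def by (simp add: u)
      moreover have "ireg u 14 = i" using t by (simp add: u)
      moreover have "holds (ILess 19 3) t" using False t core by (simp add: core_def)
      ultimately show ?thesis
        using big n' unfolding u_def by (intro wp_Cond wp_Do) (auto simp: Inv_def simp del: fold.simps)
    qed
    then show "2 \<le> n' \<and> wp (Do ?load ;;
        Cond (ILess 19 3) (Do [IStore 20 3, ISub 16 16 3, IStore 16 17]) (Do [])) Inv s' (n' - 2)"
      using big unfolding t_def by (intro conjI wp_Seq wp_Do) (auto simp del: fold.simps)
  next
    fix s' n' assume inv: "Inv s' n'" and h: "\<not> holds (ILess 2 14) s'"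
    then have core: "core s'" by (simp add: Inv_def)
    then have 0: "ireg s' 14 = 0" using h by (auto simp: core_def)
    then have "ireg s' 16 = m + 2 * len - card (set \<Xi>)" using core by (auto simp: core_def)
    moreover have "2 \<le> n'" "n \<le> n' - 2 + 12 * m + 8"
      using inv 0 n by (auto simp: Inv_def)
    ultimately show "2 \<le> n' \<and> rmem s' = rmem s \<and> ireg s' 0 = len \<and> ireg s' 2 = 0 \<and>
      ireg s' 3 = 1 \<and> ireg s' 4 = m + len \<and> ireg s' 5 = m + 2 * len \<and> ireg s' 6 = m + 3 * len \<and>
      seg (imem s') (m + 2 * len - card (set \<Xi>)) (m + 2 * len) = remdups \<Xi> \<and>
      n \<le> n' - 2 + 12 * m + 8"
      using core 0 by (simp add: core_def)
  qed (use n in auto)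
qed

theorem theorem3:
  "\<exists>(prog :: instr list) (C :: real). C > 0 \<and>
     (\<forall>(R :: real set list) (\<Xi> :: nat list) (\<alpha> :: real) (\<beta> :: real) (P :: real list).
        (\<forall>J \<in> set R. unit_interval J) \<longrightarrow>
        smooth_supersequence \<alpha> \<beta> R \<Xi> \<longrightarrow>
        realization R P \<longrightarrow>
        (\<exists>t :: nat.
           real t \<le> C * real (max 1 (length \<Xi>)) * log 2 (max 2 (\<alpha> * \<beta>)) \<and>
           halted prog (run prog t (initial_config R \<Xi> P)) \<and>
           sorted_order P (output_array (length R) (run prog t (initial_config R \<Xi> P)))))"
proof (rule exI[of _ "compile 0 (dedup_code ;; sort_code)"], rule exI[of _ 600],
    intro conjI allI impI)
  show "(600 :: real) > 0" by simp
next
  fix R :: "real set list" and \<Xi> :: "nat list" and \<alpha> \<beta> :: real and P :: "real list"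
  assume U: "\<forall>J \<in> set R. unit_interval J" and S: "smooth_supersequence \<alpha> \<beta> R \<Xi>"
    and P: "realization R P"
  let ?c = "dedup_code ;; sort_code" and ?s = "initial_config R \<Xi> P"
  let ?n = "length R" and ?m = "length \<Xi>"
  obtain e where loc: "local_order (2 ^ e) (map ((!) P) (remdups \<Xi>))"
    and e: "real e + 1 \<le> 4 * log 2 (max 2 (\<alpha> * \<beta>))"
    using local_order_remdups[OF U S P] by blast
  have set_\<Xi>: "set \<Xi> = {..<?n}"
    using S P set_sorting_supersequence by (auto simp: smooth_supersequence_def)
  then have card: "card (set \<Xi>) = ?n" by simp
  have init: "pc ?s = 0" "ireg ?s 0 = ?n" "ireg ?s 1 = ?m" "ireg ?s 2 = 0"
    "imem ?s = (\<lambda>a. if a < ?m then \<Xi> ! a else 0)"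
    by (simp_all add: initial_config_def Let_def)
  have rmem: "map (rmem ?s) xs = map ((!) P) xs" if "set xs \<subseteq> {..<?n}" for xs
    using that P by (auto simp: initial_config_def Let_def realization_def nth_append)
  define T where "T = (e + 1) * (100 * ?n + 40) + 5 + (12 * ?m + 8)"
  let ?Q = "\<lambda>s n. mset (seg (imem s) (ireg s 0) (ireg s 0 + ?n)) = mset (remdups \<Xi>) \<and>
    sorted (map (rmem ?s) (seg (imem s) (ireg s 0) (ireg s 0 + ?n)))"
  have "wp dedup_code (wp sort_code ?Q) ?s T"
  proof (rule wp_mono[OF wp_dedup_code[where \<Xi> = \<Xi>]])
    fix s :: config and n
    assume A: "rmem s = rmem ?s \<and> ireg s 0 = ireg ?s 0 \<and> ireg s 2 = 0 \<and> ireg s 3 = 1 \<and>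
      ireg s 4 = ireg ?s 1 + ireg ?s 0 \<and> ireg s 5 = ireg ?s 1 + 2 * ireg ?s 0 \<and>
      ireg s 6 = ireg ?s 1 + 3 * ireg ?s 0 \<and>
      seg (imem s) (ireg ?s 1 + 2 * ireg ?s 0 - card (set \<Xi>)) (ireg ?s 1 + 2 * ireg ?s 0) =
        remdups \<Xi> \<and>
      T \<le> n + 12 * ireg ?s 1 + 8"
    note A = A[unfolded init]
    have regs: "rmem s = rmem ?s" "ireg s 0 = ?n" "ireg s 2 = 0" "ireg s 3 = 1"
      "ireg s 4 = ?m + ?n" "ireg s 5 = ?m + 2 * ?n" "ireg s 6 = ?m + 3 * ?n"
      and n: "(e + 1) * (100 * ?n + 40) + 5 \<le> n"
      using A by (auto simp: T_def)
    have "?m + 2 * ?n - card (set \<Xi>) = ?m + ?n" using card by simp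
    then have ys: "seg (imem s) (?m + ?n) (?m + 2 * ?n) = remdups \<Xi>"
      using A by simp
    have ys': "seg (imem s) (ireg s 4) (ireg s 4 + ireg s 0) = remdups \<Xi>"
      using ys by (simp add: regs mult_2 add.assoc)
    show "wp sort_code ?Q s n"
    proof (rule wp_mono[OF wp_sort_code[where e = e]])
      show "local_order (2 ^ e) (map (rmem s) (seg (imem s) (ireg s 4) (ireg s 4 + ireg s 0)))"
        unfolding ys' regs(1) using loc set_\<Xi> by (subst rmem) simp_all
    qed (use regs n ys' in auto)
  qed (use init set_\<Xi> in \<open>auto simp: T_def\<close>)
  then have "wp ?c ?Q ?s T" by (rule wp_Seq)
  then obtain t s' where t: "t \<le> T" and run: "run (compile 0 ?c) t ?s = s'\<lparr>pc := code_size ?c\<rparr>"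
    and Q: "?Q s' (T - t)"
    using init(1) by (rule wp_run)
  define zs where "zs = seg (imem s') (ireg s' 0) (ireg s' 0 + ?n)"
  have zs: "mset zs = mset (remdups \<Xi>)" "sorted (map (rmem ?s) zs)"
    using Q by (auto simp: zs_def)
  have set_zs: "set zs = {..<?n}"
    using mset_eq_setD[OF zs(1)] set_\<Xi> by simp
  moreover have "distinct zs"
    using zs(1) mset_eq_imp_distinct_iff[of zs "remdups \<Xi>"] by simp
  moreover have "sorted (map ((!) P) zs)"
    using zs(2) unfolding rmem[OF equalityD1[OF set_zs]] .
  ultimately have "sorted_order P zs"
    using P by (simp add: sorted_order_def realization_def)
  moreover have "output_array ?n (run (compile 0 ?c) t ?s) = zs"
    unfolding run output_array_def zs_def seg_def by (rule nth_equalityI) auto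
  ultimately have "sorted_order P (output_array ?n (run (compile 0 ?c) t ?s))"
    by metis
  moreover have "halted (compile 0 ?c) (run (compile 0 ?c) t ?s)"
    unfolding run halted_def length_compile by simp
  moreover have "real t \<le> 600 * real (max 1 ?m) * log 2 (max 2 (\<alpha> * \<beta>))"
  proof -
    define M L where "M = real (max 1 ?m)" and "L = log 2 (max 2 (\<alpha> * \<beta>))"
    have L: "1 \<le> L" unfolding L_def by (subst le_log_iff) auto
    have M: "1 \<le> M" "real ?m \<le> M" by (auto simp: M_def)
    \<comment> \<open>Every interval occurs in \<Xi>.\<close>
    have "?n \<le> ?m" using card card_length[of \<Xi>] by simp
    then have n: "real ?n \<le> M" using M(2) by linarith
    have le: "M \<le> M * L" using M L by simp
    have "real t \<le> real T" using t by simp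
    also have "\<dots> = (real e + 1) * (100 * real ?n + 40) + 12 * real ?m + 13"
      by (simp add: T_def algebra_simps)
    \<comment> \<open>\<open>4 * L\<close> bounds the rounds and \<open>140 * M\<close> the cost of
      one, since \<open>1 \<le> M\<close>. The product contributes 560, and
      \<open>12 * ?m + 13\<close> at most 25 more, which stays below 600.\<close>
    also have "(real e + 1) * (100 * real ?n + 40) \<le> (4 * L) * (140 * M)"
      using e n M L by (intro mult_mono) (auto simp: L_def)
    also have "(4 * L) * (140 * M) + 12 * real ?m + 13 \<le> 600 * M * L"
    proof -
      have "(4 * L) * (140 * M) = 560 * (M * L)" "600 * M * L = 600 * (M * L)" by simp_all
      then show ?thesis using le M by linarith
    qed
    finally show ?thesis by (simp add: M_def L_def)
  qed
  ultimately show "\<exists>t. real t \<le> 600 * real (max 1 ?m) * log 2 (max 2 (\<alpha> * \<beta>)) \<and>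
      halted (compile 0 ?c) (run (compile 0 ?c) t ?s) \<and>
      sorted_order P (output_array ?n (run (compile 0 ?c) t ?s))"
    by blast
qed

end
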